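(* Let $T$ be a finite index set, let $\mathbf{L}_t$, $t\in T$, be pairwise non-isomorphic irreducible lattices, let $e_t\in \mathbb{N}$ for every $t\in T$, and let $\mathbf{L}:=\prod_{t\in T}\mathbf{L}_t^{e_t}$. Then $$|\mathrm{Aut}(\mathbf{L})| = \prod_{t\in T}\Big(e_t!\cdot |\mathrm{Aut}(\mathbf{L}_t)|^{e_t}\Big).$$ In particular, for a finite index set $I$, $$|\mathrm{Aut}(\mathbf{L}^I)| = \prod_{t\in T}\Big((e_t \cdot |I|)!\cdot |\mathrm{Aut}(\mathbf{L}_t)|^{e_t\cdot |I|}\Big),$$ and, when the lattices $\mathbf{L}_t$ are finite, this is exactly the number of invertible matrices in $\mathrm{Mat}_{I\times I}(\mathrm{Res}(\mathbf{L}))$.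
   Context: A lattice is called irreducible if it has more than one element and is not isomorphic to a direct product of two lattices each having more than one element. $\mathrm{Aut}(\mathbf{L})$ is the set of lattice (equivalently, order) automorphisms of $\mathbf{L}$, and $|\cdot|$ denotes cardinality. For a finite lattice $\mathbf{L}=(L,\leq)$ with least element $0_{\mathbf{L}}$, $\mathrm{Res}(\mathbf{L})$ is the set of residuated mappings $f:L\to L$, i.e. those with $f(x\vee y)=f(x)\vee f(y)$ for all $x,y\in L$ and $f(0_{\mathbf{L}})=0_{\mathbf{L}}$. $(\mathrm{Res}(\mathbf{L}),\vee,\circ)$, with pointwise supremum as addition and composition as multiplication, is a semiring with zero the constant mapping $x\mapsto 0_{\mathbf{L}}$ and one $\mathrm{id}_L$. $\mathrm{Mat}_{I\times I}(\mathrm{Res}(\mathbf{L}))$ is the semiring of $I\times I$ matrices over this semiring, with product $(f_{i,j})\cdot(g_{i,j})=(h_{i,j})$, $h_{i,j}=\bigvee_{k\in I}f_{i,k}\circ g_{k,j}$. A matrix is invertible if it has a two-sided inverse with respect to this product (the identity matrix has $\mathrm{id}_L$ on the diagonal and the zero mapping elsewhere). *)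

theory Defs
  imports "HOL-Algebra.Algebra"
begin

unbundle cardinal_syntax

section \<open>Lattices\<close>

definition lattice_iso :: "'a gorder \<Rightarrow> 'b gorder \<Rightarrow> ('a \<Rightarrow> 'b) \<Rightarrow> bool" where
  "lattice_iso L M f \<longleftrightarrow> order_emb L M f \<and> bij_betw f (carrier L) (carrier M)"

definition lattice_isomorphic :: "'a gorder \<Rightarrow> 'b gorder \<Rightarrow> bool" where
  "lattice_isomorphic L M \<longleftrightarrow> (\<exists>f. lattice_iso L M f)"

definition Aut :: "'a gorder \<Rightarrow> ('a \<Rightarrow> 'a) set" where
  "Aut L = {f \<in> Bij (carrier L). lattice_iso L L f}"

definition lattice_times :: "'a gorder \<Rightarrow> 'b gorder \<Rightarrow> ('a \<times> 'b) gorder" where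
  "lattice_times M N =
     \<lparr>carrier = carrier M \<times> carrier N, eq = (=),
      le = (\<lambda>p q. fst p \<sqsubseteq>\<^bsub>M\<^esub> fst q \<and> snd p \<sqsubseteq>\<^bsub>N\<^esub> snd q)\<rparr>"

definition lattice_prod :: "'i set \<Rightarrow> ('i \<Rightarrow> 'a gorder) \<Rightarrow> ('i \<Rightarrow> 'a) gorder" where
  "lattice_prod I L =
     \<lparr>carrier = (\<Pi>\<^sub>E i\<in>I. carrier (L i)), eq = (=),
      le = (\<lambda>x y. \<forall>i\<in>I. x i \<sqsubseteq>\<^bsub>L i\<^esub> y i)\<rparr>"

definition lattice_power :: "'a gorder \<Rightarrow> 'i set \<Rightarrow> ('i \<Rightarrow> 'a) gorder" where
  "lattice_power L I = lattice_prod I (\<lambda>_. L)"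

definition nontrivial_lattice :: "'a gorder \<Rightarrow> bool" where
  "nontrivial_lattice L \<longleftrightarrow> lattice L \<and> (\<exists>x\<in>carrier L. \<exists>y\<in>carrier L. x \<noteq> y)"

text \<open>
  The factors \<open>M\<close> and \<open>N\<close> may be taken over the type of \<open>L\<close> itself: if \<open>L\<close> is isomorphic to
  a product of two nonempty lattices over any types, then fixing an element of one factor embeds
  the other factor into \<open>L\<close>, so both are isomorphic to lattices over that type.
\<close>

definition irreducible_lattice :: "'a gorder \<Rightarrow> bool" where
  "irreducible_lattice L \<longleftrightarrow>
     nontrivial_lattice L \<and>
     \<not> (\<exists>(M :: 'a gorder) (N :: 'a gorder). nontrivial_lattice M \<and> nontrivial_lattice N \<and>
           lattice_isomorphic L (lattice_times M N))"

section \<open>The semiring of residuated mappings and matrices over a semiring\<close>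

text \<open>Residuated mappings are extensional, so that each one is represented exactly once.\<close>

definition residuated_maps :: "'a gorder \<Rightarrow> ('a \<Rightarrow> 'a) set" where
  "residuated_maps L =
     {f \<in> carrier L \<rightarrow>\<^sub>E carrier L.
        (\<forall>x\<in>carrier L. \<forall>y\<in>carrier L. f (x \<squnion>\<^bsub>L\<^esub> y) = f x \<squnion>\<^bsub>L\<^esub> f y) \<and> f \<bottom>\<^bsub>L\<^esub> = \<bottom>\<^bsub>L\<^esub>}"

definition Res :: "'a gorder \<Rightarrow> ('a \<Rightarrow> 'a) ring" where
  "Res L =
     \<lparr>carrier = residuated_maps L,
      monoid.mult = (\<lambda>f g. compose (carrier L) f g),
      one = (\<lambda>x\<in>carrier L. x),
      ring.zero = (\<lambda>x\<in>carrier L. \<bottom>\<^bsub>L\<^esub>),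
      ring.add = (\<lambda>f g. \<lambda>x\<in>carrier L. f x \<squnion>\<^bsub>L\<^esub> g x)\<rparr>"

definition Mat :: "'i set \<Rightarrow> 'r ring \<Rightarrow> ('i \<times> 'i \<Rightarrow> 'r) ring" where
  "Mat I R =
     \<lparr>carrier = I \<times> I \<rightarrow>\<^sub>E carrier R,
      monoid.mult = (\<lambda>f g. \<lambda>(i, j)\<in>I \<times> I. \<Oplus>\<^bsub>R\<^esub>k\<in>I. f (i, k) \<otimes>\<^bsub>R\<^esub> g (k, j)),
      one = (\<lambda>(i, j)\<in>I \<times> I. if i = j then \<one>\<^bsub>R\<^esub> else \<zero>\<^bsub>R\<^esub>),
      ring.zero = (\<lambda>(i, j)\<in>I \<times> I. \<zero>\<^bsub>R\<^esub>),
      ring.add = (\<lambda>f g. \<lambda>(i, j)\<in>I \<times> I. f (i, j) \<oplus>\<^bsub>R\<^esub> g (i, j))\<rparr>"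

section \<open>Products of families of cardinals\<close>

text \<open>The multiplicative counterpart of \<open>BNF_Cardinal_Arithmetic.Csum\<close>.\<close>

definition Cprod :: "'i set \<Rightarrow> ('i \<Rightarrow> 'a rel) \<Rightarrow> ('i \<Rightarrow> 'a) rel" where
  "Cprod I r = |\<Pi>\<^sub>E i\<in>I. Field (r i)|"

text \<open>The number of permutations and the exponents are finite; they enter cardinal arithmetic as
  the cardinal of the initial segment \<open>{..<n}\<close>.\<close>

abbreviation fincard :: "nat \<Rightarrow> nat rel" where
  "fincard n \<equiv> |{..<n}|"

end

theory Submission
  imports Defs
begin

text \<open>
  Let \<open>f\<close> be a homomorphism from a finite product of lattices onto an irreducible lattice \<open>B\<close>. Since the
  kernel of \<open>f\<close> is convex and closed under joins and meets, it is a product congruence, so for every set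
  \<open>S\<close> of coordinates \<open>B\<close> is the product of the images under \<open>f\<close> of the slice through a point along \<open>S\<close>
  and of the slice along the complement of \<open>S\<close>. By irreducibility one of the two is trivial, hence \<open>f\<close>
  depends on a single coordinate. Applied to the components of an isomorphism and of its inverse, this shows
  that isomorphisms between finite products of irreducible lattices permute the factors and act
  factorwise. An automorphism of \<open>L\<close> therefore amounts to a permutation of the copies of each \<open>L t\<close>
  and an automorphism of each copy. For the matrices, \<open>Mat I (Res P)\<close> is isomorphic as a monoid to
  \<open>Res\<close> of the power \<open>P\<close> to the \<open>I\<close>, whose units are the automorphisms.
\<close>

section \<open>Lattice isomorphisms and products\<close>

text \<open>The factors may be infinite and need not have a least element, so no factor sits inside
  the product in a canonical way. Slices are therefore taken through an arbitrary base point
  \<open>a\<close>, and what is found over one base point is carried to another by a join followed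
  by a meet (\<open>f_eq_transfer\<close>); no distributivity is required for this. Irreducibility
  is tested only against factors over the type of the lattice itself. The images of slices qualify
  because they are subsets of the codomain \<open>B\<close> with the order of \<open>B\<close>. That
  factors have two distinct elements is used a second time, after irreducibility: varying one entry
  then visibly changes the result, which makes the coordinate that an entry depends on unique and
  hence the coordinate maps bijective and the permutations well determined. The exponent
  \<open>e t * card I\<close> arises by regrouping the nested indices so that all copies of
  \<open>L t\<close> form one block \<open>I \<times> E t\<close>. The formula for \<open>P\<close>
  itself is then the case of a one-element index set.\<close>

lemma lattice_isoI:
  assumes "partial_order L" and "partial_order M"
    and "f ` carrier L = carrier M"
    and "\<And>x y. x \<in> carrier L \<Longrightarrow> y \<in> carrier L \<Longrightarrow> f x \<sqsubseteq>\<^bsub>M\<^esub> f y \<longleftrightarrow> x \<sqsubseteq>\<^bsub>L\<^esub> y"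
  shows "lattice_iso L M f"
proof -
  interpret L: partial_order L by fact
  interpret M: partial_order M by fact
  have "inj_on f (carrier L)"
    by (rule inj_onI) (metis L.le_antisym L.le_refl assms(4))
  with assms show ?thesis
    by (auto simp: lattice_iso_def order_emb_def bij_betw_def L.weak_partial_order_axioms
        M.weak_partial_order_axioms)
qed

lemma lattice_iso_le_iff:
  "lattice_iso L M f \<Longrightarrow> x \<in> carrier L \<Longrightarrow> y \<in> carrier L \<Longrightarrow> f x \<sqsubseteq>\<^bsub>M\<^esub> f y \<longleftrightarrow> x \<sqsubseteq>\<^bsub>L\<^esub> y"
  by (auto simp: lattice_iso_def order_emb_def)

lemma lattice_iso_bij: "lattice_iso L M f \<Longrightarrow> bij_betw f (carrier L) (carrier M)"
  by (simp add: lattice_iso_def)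

lemma lattice_iso_closed: "lattice_iso L M f \<Longrightarrow> x \<in> carrier L \<Longrightarrow> f x \<in> carrier M"
  by (blast dest: lattice_iso_bij bij_betw_apply)

lemma lattice_iso_cong:
  assumes "\<And>x. x \<in> carrier L \<Longrightarrow> f x = g x"
  shows "lattice_iso L M f \<longleftrightarrow> lattice_iso L M g"
  using assms by (auto simp: lattice_iso_def order_emb_def image_iff cong: bij_betw_cong)

lemma lattice_iso_trans:
  "lattice_iso L M f \<Longrightarrow> lattice_iso M N g \<Longrightarrow> lattice_iso L N (g \<circ> f)"
  unfolding lattice_iso_def order_emb_def
  by (auto intro: bij_betw_trans simp: bij_betw_apply)

lemma lattice_iso_inv:
  assumes "lattice_iso L M f"
  shows "lattice_iso M L (inv_into (carrier L) f)"
proof -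
  let ?g = "inv_into (carrier L) f"
  note bij = lattice_iso_bij[OF assms]
  have g: "?g x \<in> carrier L" "f (?g x) = x" if "x \<in> carrier M" for x
    using that bij_betw_apply[OF bij_betw_inv_into[OF bij]] bij_betw_inv_into_right[OF bij] by auto
  have "?g x \<sqsubseteq>\<^bsub>L\<^esub> ?g y \<longleftrightarrow> x \<sqsubseteq>\<^bsub>M\<^esub> y" if "x \<in> carrier M" "y \<in> carrier M" for x y
    using lattice_iso_le_iff[OF assms g(1)[OF that(1)] g(1)[OF that(2)]] g(2) that by simp
  then show ?thesis
    using assms bij_betw_inv_into[OF bij] by (simp add: lattice_iso_def order_emb_def)
qed

lemma (in lattice) join_eqI:
  assumes "x \<in> carrier L" "y \<in> carrier L" "s \<in> carrier L" "x \<sqsubseteq> s" "y \<sqsubseteq> s"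
    and "\<And>z. z \<in> carrier L \<Longrightarrow> x \<sqsubseteq> z \<Longrightarrow> y \<sqsubseteq> z \<Longrightarrow> s \<sqsubseteq> z"
  shows "x \<squnion> y = s"
proof (rule le_antisym)
  show "s \<sqsubseteq> x \<squnion> y"
    using assms by (intro assms(6) join_left join_right join_closed)
qed (use assms in \<open>auto intro: join_le\<close>)

lemma (in lattice) meet_eqI:
  assumes "x \<in> carrier L" "y \<in> carrier L" "s \<in> carrier L" "s \<sqsubseteq> x" "s \<sqsubseteq> y"
    and "\<And>z. z \<in> carrier L \<Longrightarrow> z \<sqsubseteq> x \<Longrightarrow> z \<sqsubseteq> y \<Longrightarrow> z \<sqsubseteq> s"
  shows "x \<sqinter> y = s"
proof (rule le_antisym)
  show "x \<sqinter> y \<sqsubseteq> s"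
    using assms by (intro assms(6) meet_left meet_right meet_closed)
qed (use assms in \<open>auto intro: meet_le\<close>)

lemma latticeI:
  assumes "partial_order L"
    and "\<And>x y. x \<in> carrier L \<Longrightarrow> y \<in> carrier L \<Longrightarrow> \<exists>s\<in>carrier L. x \<sqsubseteq>\<^bsub>L\<^esub> s \<and> y \<sqsubseteq>\<^bsub>L\<^esub> s \<and>
        (\<forall>z\<in>carrier L. x \<sqsubseteq>\<^bsub>L\<^esub> z \<longrightarrow> y \<sqsubseteq>\<^bsub>L\<^esub> z \<longrightarrow> s \<sqsubseteq>\<^bsub>L\<^esub> z)"
    and "\<And>x y. x \<in> carrier L \<Longrightarrow> y \<in> carrier L \<Longrightarrow> \<exists>s\<in>carrier L. s \<sqsubseteq>\<^bsub>L\<^esub> x \<and> s \<sqsubseteq>\<^bsub>L\<^esub> y \<and>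
        (\<forall>z\<in>carrier L. z \<sqsubseteq>\<^bsub>L\<^esub> x \<longrightarrow> z \<sqsubseteq>\<^bsub>L\<^esub> y \<longrightarrow> z \<sqsubseteq>\<^bsub>L\<^esub> s)"
  shows "lattice L"
proof -
  interpret partial_order L by fact
  show ?thesis
  proof
    fix x y assume xy: "x \<in> carrier L" "y \<in> carrier L"
    obtain s where "s \<in> carrier L" "x \<sqsubseteq>\<^bsub>L\<^esub> s" "y \<sqsubseteq>\<^bsub>L\<^esub> s"
      "\<forall>z\<in>carrier L. x \<sqsubseteq>\<^bsub>L\<^esub> z \<longrightarrow> y \<sqsubseteq>\<^bsub>L\<^esub> z \<longrightarrow> s \<sqsubseteq>\<^bsub>L\<^esub> z"
      using assms(2)[OF xy] by blast
    with xy have "least L s (Upper L {x, y})"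
      by (intro least_UpperI) (auto simp: Upper_def)
    then show "\<exists>s. least L s (Upper L {x, y})" ..
    obtain i where "i \<in> carrier L" "i \<sqsubseteq>\<^bsub>L\<^esub> x" "i \<sqsubseteq>\<^bsub>L\<^esub> y"
      "\<forall>z\<in>carrier L. z \<sqsubseteq>\<^bsub>L\<^esub> x \<longrightarrow> z \<sqsubseteq>\<^bsub>L\<^esub> y \<longrightarrow> z \<sqsubseteq>\<^bsub>L\<^esub> i"
      using assms(3)[OF xy] by blast
    with xy have "greatest L i (Lower L {x, y})"
      by (intro greatest_LowerI) (auto simp: Lower_def)
    then show "\<exists>i. greatest L i (Lower L {x, y})" ..
  qed
qed

lemma lattice_iso_join:
  assumes "lattice L" "lattice M" "lattice_iso L M f" "x \<in> carrier L" "y \<in> carrier L"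
  shows "f (x \<squnion>\<^bsub>L\<^esub> y) = f x \<squnion>\<^bsub>M\<^esub> f y"
proof -
  interpret L: lattice L by fact
  interpret M: lattice M by fact
  note iso = assms(3)
  have "f x \<squnion>\<^bsub>M\<^esub> f y = f (x \<squnion>\<^bsub>L\<^esub> y)"
  proof (rule M.join_eqI)
    fix z assume "z \<in> carrier M" "f x \<sqsubseteq>\<^bsub>M\<^esub> z" "f y \<sqsubseteq>\<^bsub>M\<^esub> z"
    moreover obtain w where "w \<in> carrier L" "z = f w"
      using \<open>z \<in> carrier M\<close> lattice_iso_bij[OF iso] by (auto simp: bij_betw_def)
    ultimately show "f (x \<squnion>\<^bsub>L\<^esub> y) \<sqsubseteq>\<^bsub>M\<^esub> z"
      using assms by (simp add: lattice_iso_le_iff[OF iso] L.join_le)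
  qed (use assms in \<open>auto simp: lattice_iso_le_iff[OF iso] lattice_iso_closed[OF iso]
        intro: L.join_left L.join_right\<close>)
  then show ?thesis by simp
qed

lemma lattice_iso_meet:
  assumes "lattice L" "lattice M" "lattice_iso L M f" "x \<in> carrier L" "y \<in> carrier L"
  shows "f (x \<sqinter>\<^bsub>L\<^esub> y) = f x \<sqinter>\<^bsub>M\<^esub> f y"
proof -
  interpret L: lattice L by fact
  interpret M: lattice M by fact
  note iso = assms(3)
  have "f x \<sqinter>\<^bsub>M\<^esub> f y = f (x \<sqinter>\<^bsub>L\<^esub> y)"
  proof (rule M.meet_eqI)
    fix z assume "z \<in> carrier M" "z \<sqsubseteq>\<^bsub>M\<^esub> f x" "z \<sqsubseteq>\<^bsub>M\<^esub> f y"
    moreover obtain w where "w \<in> carrier L" "z = f w"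
      using \<open>z \<in> carrier M\<close> lattice_iso_bij[OF iso] by (auto simp: bij_betw_def)
    ultimately show "z \<sqsubseteq>\<^bsub>M\<^esub> f (x \<sqinter>\<^bsub>L\<^esub> y)"
      using assms by (simp add: lattice_iso_le_iff[OF iso] L.meet_le)
  qed (use assms in \<open>auto simp: lattice_iso_le_iff[OF iso] lattice_iso_closed[OF iso]
        intro: L.meet_left L.meet_right\<close>)
  then show ?thesis by simp
qed

text \<open>Only the carrier shrinks, while type and order stay those of \<open>L\<close>. This
  makes images of slices admissible as the factors in \<open>irreducible_lattice\<close>.\<close>

lemma sublattice:
  assumes "lattice L" "S \<subseteq> carrier L"
    and "\<And>x y. x \<in> S \<Longrightarrow> y \<in> S \<Longrightarrow> x \<squnion>\<^bsub>L\<^esub> y \<in> S" "\<And>x y. x \<in> S \<Longrightarrow> y \<in> S \<Longrightarrow> x \<sqinter>\<^bsub>L\<^esub> y \<in> S"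
  shows "lattice (L\<lparr>carrier := S\<rparr>)"
proof -
  interpret L: lattice L by fact
  have S: "x \<in> carrier L" if "x \<in> S" for x using assms(2) that by auto
  show ?thesis
  proof (rule latticeI)
    show "partial_order (L\<lparr>carrier := S\<rparr>)"
      by unfold_locales (auto simp: L.eq_is_equal intro: S L.le_antisym L.le_trans)
  next
    fix x y assume "x \<in> carrier (L\<lparr>carrier := S\<rparr>)" "y \<in> carrier (L\<lparr>carrier := S\<rparr>)"
    then have xy: "x \<in> S" "y \<in> S" by auto
    show "\<exists>s\<in>carrier (L\<lparr>carrier := S\<rparr>). x \<sqsubseteq>\<^bsub>L\<lparr>carrier := S\<rparr>\<^esub> s \<and> y \<sqsubseteq>\<^bsub>L\<lparr>carrier := S\<rparr>\<^esub> s \<and>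
        (\<forall>z\<in>carrier (L\<lparr>carrier := S\<rparr>). x \<sqsubseteq>\<^bsub>L\<lparr>carrier := S\<rparr>\<^esub> z \<longrightarrow> y \<sqsubseteq>\<^bsub>L\<lparr>carrier := S\<rparr>\<^esub> z \<longrightarrow> s \<sqsubseteq>\<^bsub>L\<lparr>carrier := S\<rparr>\<^esub> z)"
      by (rule bexI[of _ "x \<squnion>\<^bsub>L\<^esub> y"]) (use xy S assms(3) in \<open>auto intro: L.join_left L.join_right L.join_le\<close>)
    show "\<exists>s\<in>carrier (L\<lparr>carrier := S\<rparr>). s \<sqsubseteq>\<^bsub>L\<lparr>carrier := S\<rparr>\<^esub> x \<and> s \<sqsubseteq>\<^bsub>L\<lparr>carrier := S\<rparr>\<^esub> y \<and>
        (\<forall>z\<in>carrier (L\<lparr>carrier := S\<rparr>). z \<sqsubseteq>\<^bsub>L\<lparr>carrier := S\<rparr>\<^esub> x \<longrightarrow> z \<sqsubseteq>\<^bsub>L\<lparr>carrier := S\<rparr>\<^esub> y \<longrightarrow> z \<sqsubseteq>\<^bsub>L\<lparr>carrier := S\<rparr>\<^esub> s)"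
      by (rule bexI[of _ "x \<sqinter>\<^bsub>L\<^esub> y"]) (use xy S assms(4) in \<open>auto intro: L.meet_left L.meet_right L.meet_le\<close>)
  qed
qed

section \<open>Binary and indexed products, with their componentwise operations\<close>

lemma partial_order_lattice_times:
  assumes "partial_order M" "partial_order N"
  shows "partial_order (lattice_times M N)"
proof -
  interpret M: partial_order M by fact
  interpret N: partial_order N by fact
  show ?thesis
    by unfold_locales (auto simp: lattice_times_def intro: M.le_antisym N.le_antisym M.le_trans N.le_trans)
qed

lemma carrier_lattice_prod [simp]: "carrier (lattice_prod K A) = (\<Pi>\<^sub>E k\<in>K. carrier (A k))"
  by (simp add: lattice_prod_def)

lemma le_lattice_prod [simp]: "x \<sqsubseteq>\<^bsub>lattice_prod K A\<^esub> y \<longleftrightarrow> (\<forall>k\<in>K. x k \<sqsubseteq>\<^bsub>A k\<^esub> y k)"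
  by (simp add: lattice_prod_def)

lemma partial_order_lattice_prod:
  assumes "\<And>k. k \<in> K \<Longrightarrow> partial_order (A k)"
  shows "partial_order (lattice_prod K A)"
proof
  fix x y
  assume "x \<sqsubseteq>\<^bsub>lattice_prod K A\<^esub> y" "y \<sqsubseteq>\<^bsub>lattice_prod K A\<^esub> x"
    "x \<in> carrier (lattice_prod K A)" "y \<in> carrier (lattice_prod K A)"
  then have "x = y"
    by (auto intro!: PiE_ext[of x K "\<lambda>k. carrier (A k)" y]
        partial_order.le_antisym[OF assms])
  then show "x .=\<^bsub>lattice_prod K A\<^esub> y" by (simp add: lattice_prod_def)
next
  fix x y z
  assume *: "x \<sqsubseteq>\<^bsub>lattice_prod K A\<^esub> y" "y \<sqsubseteq>\<^bsub>lattice_prod K A\<^esub> z"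
    "x \<in> carrier (lattice_prod K A)" "y \<in> carrier (lattice_prod K A)" "z \<in> carrier (lattice_prod K A)"
  show "x \<sqsubseteq>\<^bsub>lattice_prod K A\<^esub> z"
    unfolding le_lattice_prod
  proof
    fix k assume k: "k \<in> K"
    interpret partial_order "A k" using assms k .
    show "x k \<sqsubseteq>\<^bsub>A k\<^esub> z k"
      by (rule le_trans[of _ "y k"]) (use * k in auto)
  qed
next
  fix x assume "x \<in> carrier (lattice_prod K A)"
  then show "x \<sqsubseteq>\<^bsub>lattice_prod K A\<^esub> x"
    by (auto intro: weak_partial_order.le_refl[OF partial_order.axioms(1)[OF assms]])
qed (auto simp: lattice_prod_def)

lemma lattice_imp_partial_order: "lattice L \<Longrightarrow> partial_order L"
  by (simp add: lattice_def upper_semilattice_def)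

text \<open>Formulated as a universal property because the product is not yet known to be a lattice;
  the same four facts later prove that it is one and evaluate its joins.\<close>

lemma lattice_prod_pointwise_join:
  assumes lat: "\<And>k. k \<in> K \<Longrightarrow> lattice (A k)"
    and xy: "x \<in> carrier (lattice_prod K A)" "y \<in> carrier (lattice_prod K A)"
  defines "s \<equiv> (\<lambda>k\<in>K. x k \<squnion>\<^bsub>A k\<^esub> y k)"
  shows "s \<in> carrier (lattice_prod K A)"
    and "x \<sqsubseteq>\<^bsub>lattice_prod K A\<^esub> s" and "y \<sqsubseteq>\<^bsub>lattice_prod K A\<^esub> s"
    and "\<And>z. z \<in> carrier (lattice_prod K A) \<Longrightarrow> x \<sqsubseteq>\<^bsub>lattice_prod K A\<^esub> z \<Longrightarrow>
      y \<sqsubseteq>\<^bsub>lattice_prod K A\<^esub> z \<Longrightarrow> s \<sqsubseteq>\<^bsub>lattice_prod K A\<^esub> z"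
proof -
  have k: "x k \<in> carrier (A k)" "y k \<in> carrier (A k)" if "k \<in> K" for k
    using xy that by auto
  have "x k \<squnion>\<^bsub>A k\<^esub> y k \<in> carrier (A k)" if "k \<in> K" for k
  proof -
    interpret lattice "A k" using lat that .
    show ?thesis using k[OF that] by simp
  qed
  then show "s \<in> carrier (lattice_prod K A)"
    by (auto simp: s_def)
  show "x \<sqsubseteq>\<^bsub>lattice_prod K A\<^esub> s" "y \<sqsubseteq>\<^bsub>lattice_prod K A\<^esub> s"
    unfolding le_lattice_prod s_def
  proof -
    have "x k \<sqsubseteq>\<^bsub>A k\<^esub> x k \<squnion>\<^bsub>A k\<^esub> y k" "y k \<sqsubseteq>\<^bsub>A k\<^esub> x k \<squnion>\<^bsub>A k\<^esub> y k" if "k \<in> K" for k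
    proof -
      interpret lattice "A k" using lat that .
      show "x k \<sqsubseteq>\<^bsub>A k\<^esub> x k \<squnion>\<^bsub>A k\<^esub> y k" "y k \<sqsubseteq>\<^bsub>A k\<^esub> x k \<squnion>\<^bsub>A k\<^esub> y k"
        using k[OF that] by (auto intro: join_left join_right)
    qed
    then show "\<forall>k\<in>K. x k \<sqsubseteq>\<^bsub>A k\<^esub> (\<lambda>k\<in>K. x k \<squnion>\<^bsub>A k\<^esub> y k) k" "\<forall>k\<in>K. y k \<sqsubseteq>\<^bsub>A k\<^esub> (\<lambda>k\<in>K. x k \<squnion>\<^bsub>A k\<^esub> y k) k" by auto
  qed
  fix z assume z: "z \<in> carrier (lattice_prod K A)" "x \<sqsubseteq>\<^bsub>lattice_prod K A\<^esub> z" "y \<sqsubseteq>\<^bsub>lattice_prod K A\<^esub> z"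
  show "s \<sqsubseteq>\<^bsub>lattice_prod K A\<^esub> z"
    unfolding le_lattice_prod
  proof
    fix k assume kK: "k \<in> K"
    interpret lattice "A k" using lat kK .
    show "s k \<sqsubseteq>\<^bsub>A k\<^esub> z k"
      using z k[OF kK] kK by (auto simp: s_def intro!: join_le)
  qed
qed

lemma lattice_prod_pointwise_meet:
  assumes lat: "\<And>k. k \<in> K \<Longrightarrow> lattice (A k)"
    and xy: "x \<in> carrier (lattice_prod K A)" "y \<in> carrier (lattice_prod K A)"
  defines "s \<equiv> (\<lambda>k\<in>K. x k \<sqinter>\<^bsub>A k\<^esub> y k)"
  shows "s \<in> carrier (lattice_prod K A)"
    and "s \<sqsubseteq>\<^bsub>lattice_prod K A\<^esub> x" and "s \<sqsubseteq>\<^bsub>lattice_prod K A\<^esub> y"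
    and "\<And>z. z \<in> carrier (lattice_prod K A) \<Longrightarrow> z \<sqsubseteq>\<^bsub>lattice_prod K A\<^esub> x \<Longrightarrow>
      z \<sqsubseteq>\<^bsub>lattice_prod K A\<^esub> y \<Longrightarrow> z \<sqsubseteq>\<^bsub>lattice_prod K A\<^esub> s"
proof -
  have k: "x k \<in> carrier (A k)" "y k \<in> carrier (A k)" if "k \<in> K" for k
    using xy that by auto
  have "x k \<sqinter>\<^bsub>A k\<^esub> y k \<in> carrier (A k)" if "k \<in> K" for k
  proof -
    interpret lattice "A k" using lat that .
    show ?thesis using k[OF that] by simp
  qed
  then show "s \<in> carrier (lattice_prod K A)"
    by (auto simp: s_def)
  show "s \<sqsubseteq>\<^bsub>lattice_prod K A\<^esub> x" "s \<sqsubseteq>\<^bsub>lattice_prod K A\<^esub> y"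
    unfolding le_lattice_prod s_def
  proof -
    have "x k \<sqinter>\<^bsub>A k\<^esub> y k \<sqsubseteq>\<^bsub>A k\<^esub> x k" "x k \<sqinter>\<^bsub>A k\<^esub> y k \<sqsubseteq>\<^bsub>A k\<^esub> y k" if "k \<in> K" for k
    proof -
      interpret lattice "A k" using lat that .
      show "x k \<sqinter>\<^bsub>A k\<^esub> y k \<sqsubseteq>\<^bsub>A k\<^esub> x k" "x k \<sqinter>\<^bsub>A k\<^esub> y k \<sqsubseteq>\<^bsub>A k\<^esub> y k"
        using k[OF that] by (auto intro: meet_left meet_right)
    qed
    then show "\<forall>k\<in>K. (\<lambda>k\<in>K. x k \<sqinter>\<^bsub>A k\<^esub> y k) k \<sqsubseteq>\<^bsub>A k\<^esub> x k" "\<forall>k\<in>K. (\<lambda>k\<in>K. x k \<sqinter>\<^bsub>A k\<^esub> y k) k \<sqsubseteq>\<^bsub>A k\<^esub> y k" by auto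
  qed
  fix z assume z: "z \<in> carrier (lattice_prod K A)" "z \<sqsubseteq>\<^bsub>lattice_prod K A\<^esub> x" "z \<sqsubseteq>\<^bsub>lattice_prod K A\<^esub> y"
  show "z \<sqsubseteq>\<^bsub>lattice_prod K A\<^esub> s"
    unfolding le_lattice_prod
  proof
    fix k assume kK: "k \<in> K"
    interpret lattice "A k" using lat kK .
    show "z k \<sqsubseteq>\<^bsub>A k\<^esub> s k"
      using z k[OF kK] kK by (auto simp: s_def intro!: meet_le)
  qed
qed

lemma lattice_lattice_prod:
  assumes "\<And>k. k \<in> K \<Longrightarrow> lattice (A k)"
  shows "lattice (lattice_prod K A)"
proof (rule latticeI)
  show "partial_order (lattice_prod K A)"
    by (simp add: assms lattice_imp_partial_order partial_order_lattice_prod)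
next
  fix x y assume xy: "x \<in> carrier (lattice_prod K A)" "y \<in> carrier (lattice_prod K A)"
  note j = lattice_prod_pointwise_join[OF assms xy] and m = lattice_prod_pointwise_meet[OF assms xy]
  show "\<exists>s\<in>carrier (lattice_prod K A). x \<sqsubseteq>\<^bsub>lattice_prod K A\<^esub> s \<and> y \<sqsubseteq>\<^bsub>lattice_prod K A\<^esub> s \<and>
      (\<forall>z\<in>carrier (lattice_prod K A). x \<sqsubseteq>\<^bsub>lattice_prod K A\<^esub> z \<longrightarrow> y \<sqsubseteq>\<^bsub>lattice_prod K A\<^esub> z \<longrightarrow> s \<sqsubseteq>\<^bsub>lattice_prod K A\<^esub> z)"
    by (rule bexI[OF _ j(1)]) (intro conjI ballI impI j(2-4))
  show "\<exists>s\<in>carrier (lattice_prod K A). s \<sqsubseteq>\<^bsub>lattice_prod K A\<^esub> x \<and> s \<sqsubseteq>\<^bsub>lattice_prod K A\<^esub> y \<and>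
      (\<forall>z\<in>carrier (lattice_prod K A). z \<sqsubseteq>\<^bsub>lattice_prod K A\<^esub> x \<longrightarrow> z \<sqsubseteq>\<^bsub>lattice_prod K A\<^esub> y \<longrightarrow> z \<sqsubseteq>\<^bsub>lattice_prod K A\<^esub> s)"
    by (rule bexI[OF _ m(1)]) (intro conjI ballI impI m(2-4))
qed

lemma lattice_prod_join:
  assumes "\<And>k. k \<in> K \<Longrightarrow> lattice (A k)"
    and "x \<in> carrier (lattice_prod K A)" "y \<in> carrier (lattice_prod K A)"
  shows "x \<squnion>\<^bsub>lattice_prod K A\<^esub> y = (\<lambda>k\<in>K. x k \<squnion>\<^bsub>A k\<^esub> y k)"
  by (rule lattice.join_eqI[OF lattice_lattice_prod[OF assms(1)] assms(2,3)])
     (assumption | rule lattice_prod_pointwise_join[OF assms])+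

lemma lattice_prod_meet:
  assumes "\<And>k. k \<in> K \<Longrightarrow> lattice (A k)"
    and "x \<in> carrier (lattice_prod K A)" "y \<in> carrier (lattice_prod K A)"
  shows "x \<sqinter>\<^bsub>lattice_prod K A\<^esub> y = (\<lambda>k\<in>K. x k \<sqinter>\<^bsub>A k\<^esub> y k)"
  by (rule lattice.meet_eqI[OF lattice_lattice_prod[OF assms(1)] assms(2,3)])
     (assumption | rule lattice_prod_pointwise_meet[OF assms])+

section \<open>Homomorphisms from a product onto an irreducible lattice\<close>

text \<open>In the application \<open>f\<close> is one component
  \<open>\<lambda>x. \<phi> x j\<close> of an isomorphism \<open>\<phi>\<close> between products, so
  \<open>B\<close> is a single factor of the target.\<close>

locale lattice_prod_hom =
  fixes K :: "'k set" and A :: "'k \<Rightarrow> 'a gorder" and B :: "'b gorder" and f :: "('k \<Rightarrow> 'a) \<Rightarrow> 'b"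
  assumes lattice_factor: "k \<in> K \<Longrightarrow> lattice (A k)"
    and lattice_codomain: "lattice B"
    and f_closed: "x \<in> carrier (lattice_prod K A) \<Longrightarrow> f x \<in> carrier B"
    and f_join: "x \<in> carrier (lattice_prod K A) \<Longrightarrow> y \<in> carrier (lattice_prod K A) \<Longrightarrow>
      f (x \<squnion>\<^bsub>lattice_prod K A\<^esub> y) = f x \<squnion>\<^bsub>B\<^esub> f y"
    and f_meet: "x \<in> carrier (lattice_prod K A) \<Longrightarrow> y \<in> carrier (lattice_prod K A) \<Longrightarrow>
      f (x \<sqinter>\<^bsub>lattice_prod K A\<^esub> y) = f x \<sqinter>\<^bsub>B\<^esub> f y"
begin

abbreviation Q where "Q \<equiv> lattice_prod K A"

sublocale Q: lattice Q
  by (rule lattice_lattice_prod) (rule lattice_factor)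

sublocale B: lattice B
  by (rule lattice_codomain)

text \<open>Splicing is the basic operation below: \<open>override_on x y S\<close> takes
  \<open>y\<close> on \<open>S\<close> and \<open>x\<close> elsewhere. With \<open>a\<close> fixed,
  the points \<open>override_on a x S\<close> form the slice through \<open>a\<close> along
  \<open>S\<close>, and the points \<open>override_on x a S\<close> the slice along the
  complement.\<close>

lemma override_on_closed:
  "x \<in> carrier Q \<Longrightarrow> y \<in> carrier Q \<Longrightarrow> override_on x y S \<in> carrier Q"
  by (auto simp: override_on_def PiE_iff extensional_def)

lemma override_on_same [simp]: "override_on x x S = x"
  by (simp add: override_on_def)

lemma join_override_on:
  assumes "x \<in> carrier Q" "y \<in> carrier Q" "x' \<in> carrier Q" "y' \<in> carrier Q"
  shows "override_on x y S \<squnion>\<^bsub>Q\<^esub> override_on x' y' S = override_on (x \<squnion>\<^bsub>Q\<^esub> x') (y \<squnion>\<^bsub>Q\<^esub> y') S"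
  using assms
  by (simp add: lattice_prod_join[OF lattice_factor] override_on_closed del: carrier_lattice_prod)
    (auto simp: override_on_def fun_eq_iff)

lemma meet_override_on:
  assumes "x \<in> carrier Q" "y \<in> carrier Q" "x' \<in> carrier Q" "y' \<in> carrier Q"
  shows "override_on x y S \<sqinter>\<^bsub>Q\<^esub> override_on x' y' S = override_on (x \<sqinter>\<^bsub>Q\<^esub> x') (y \<sqinter>\<^bsub>Q\<^esub> y') S"
  using assms
  by (simp add: lattice_prod_meet[OF lattice_factor] override_on_closed del: carrier_lattice_prod)
    (auto simp: override_on_def fun_eq_iff)

lemma absorb:
  assumes "x \<in> carrier Q" "y \<in> carrier Q"
  shows "x \<squnion>\<^bsub>Q\<^esub> (y \<squnion>\<^bsub>Q\<^esub> x) = y \<squnion>\<^bsub>Q\<^esub> x" "x \<sqinter>\<^bsub>Q\<^esub> (y \<squnion>\<^bsub>Q\<^esub> x) = x" "x \<squnion>\<^bsub>Q\<^esub> (x \<sqinter>\<^bsub>Q\<^esub> y) = x"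
    "x \<sqinter>\<^bsub>Q\<^esub> x = x" "x \<squnion>\<^bsub>Q\<^esub> x = x"
  \<comment> \<open>The library names are misleading: \<open>le_iff_meet\<close> expresses the order
    by a join, \<open>le_iff_join\<close> by a meet.\<close>
  using assms Q.le_iff_meet[of x "y \<squnion>\<^bsub>Q\<^esub> x"] Q.le_iff_join[of x "y \<squnion>\<^bsub>Q\<^esub> x"] Q.join_right[of y x]
    Q.le_iff_meet[of "x \<sqinter>\<^bsub>Q\<^esub> y" x] Q.meet_left[of x y] join_comm[of Q x "x \<sqinter>\<^bsub>Q\<^esub> y"]
    Q.le_iff_meet[of x x] Q.le_iff_join[of x x] Q.le_refl[of x]
  by (simp_all del: carrier_lattice_prod le_lattice_prod)

lemma f_mono:
  assumes "x \<in> carrier Q" "y \<in> carrier Q" "x \<sqsubseteq>\<^bsub>Q\<^esub> y"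
  shows "f x \<sqsubseteq>\<^bsub>B\<^esub> f y"
  using assms B.le_iff_meet[of "f x" "f y"] Q.le_iff_meet[of x y] by (metis f_closed f_join)

text \<open>The spliced point lies between \<open>x \<sqinter> y\<close> and
  \<open>x \<squnion> y\<close>, and \<open>f\<close> takes the value \<open>f x\<close> at both
  ends. This is where convexity of the kernel enters.\<close>

lemma f_eq_override_on:
  assumes Q: "x \<in> carrier Q" "y \<in> carrier Q" and eq: "f x = f y"
  shows "f (override_on x y S) = f x"
proof (rule B.le_antisym)
  have "override_on x y S \<sqsubseteq>\<^bsub>Q\<^esub> x \<squnion>\<^bsub>Q\<^esub> y"
    using Q Q.join_left[OF Q] Q.join_right[OF Q] by (auto simp: override_on_def)
  then have "f (override_on x y S) \<sqsubseteq>\<^bsub>B\<^esub> f (x \<squnion>\<^bsub>Q\<^esub> y)"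
    by (intro f_mono override_on_closed Q Q.join_closed)
  also have "f (x \<squnion>\<^bsub>Q\<^esub> y) = f x"
    using Q eq by (metis absorb(5) f_join)
  finally show "f (override_on x y S) \<sqsubseteq>\<^bsub>B\<^esub> f x" .
  have "x \<sqinter>\<^bsub>Q\<^esub> y \<sqsubseteq>\<^bsub>Q\<^esub> override_on x y S"
    using Q Q.meet_left[OF Q] Q.meet_right[OF Q] by (auto simp: override_on_def)
  then have "f (x \<sqinter>\<^bsub>Q\<^esub> y) \<sqsubseteq>\<^bsub>B\<^esub> f (override_on x y S)"
    by (intro f_mono override_on_closed Q Q.meet_closed)
  also have "f (x \<sqinter>\<^bsub>Q\<^esub> y) = f x"
    using Q eq by (metis absorb(4) f_meet)
  finally show "f x \<sqsubseteq>\<^bsub>B\<^esub> f (override_on x y S)" .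
qed (use Q in \<open>auto intro!: f_closed override_on_closed simp del: carrier_lattice_prod\<close>)

text \<open>The background moves from \<open>c\<close> up to \<open>a \<squnion> c\<close> and then
  down to \<open>a\<close>. Each move joins or meets with one point shared by \<open>p\<close> and
  \<open>q\<close>, so equal values stay equal.\<close>

lemma f_eq_transfer:
  assumes Q: "p \<in> carrier Q" "q \<in> carrier Q" "c \<in> carrier Q" "a \<in> carrier Q"
    and eq: "f (override_on c p S) = f (override_on c q S)"
  shows "f (override_on a p S) = f (override_on a q S)"
proof -
  \<comment> \<open>The point joined on does not depend on \<open>r\<close>: off \<open>S\<close> it
    raises \<open>c\<close> to \<open>a \<squnion> c\<close>, and on \<open>S\<close> its entries
    \<open>p \<sqinter> q\<close> are absorbed by \<open>r\<close>.\<close>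
  have up: "f (override_on (a \<squnion>\<^bsub>Q\<^esub> c) r S) =
      f (override_on c r S) \<squnion>\<^bsub>B\<^esub> f (override_on (a \<squnion>\<^bsub>Q\<^esub> c) (p \<sqinter>\<^bsub>Q\<^esub> q) S)"
    if "r = p \<or> r = q" for r
  proof -
    have "override_on c r S \<squnion>\<^bsub>Q\<^esub> override_on (a \<squnion>\<^bsub>Q\<^esub> c) (p \<sqinter>\<^bsub>Q\<^esub> q) S
       = override_on (a \<squnion>\<^bsub>Q\<^esub> c) r S"
      using that Q by (subst join_override_on) (auto simp: absorb meet_comm[of Q p q] simp del: carrier_lattice_prod,
         metis absorb(3) meet_comm)
    then show ?thesis
      using that Q by (metis (no_types) f_join override_on_closed Q.join_closed Q.meet_closed)
  qed
  \<comment> \<open>Dually, the meet cuts \<open>a \<squnion> c\<close> down to \<open>a\<close> off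
    \<open>S\<close>, and on \<open>S\<close> the entries \<open>p \<squnion> q\<close> leave
    \<open>r\<close> unchanged.\<close>
  have down: "f (override_on a r S) =
      f (override_on a (p \<squnion>\<^bsub>Q\<^esub> q) S) \<sqinter>\<^bsub>B\<^esub> f (override_on (a \<squnion>\<^bsub>Q\<^esub> c) r S)"
    if "r = p \<or> r = q" for r
  proof -
    have "(p \<squnion>\<^bsub>Q\<^esub> q) \<sqinter>\<^bsub>Q\<^esub> r = r" "a \<sqinter>\<^bsub>Q\<^esub> (a \<squnion>\<^bsub>Q\<^esub> c) = a"
      using that Q by (metis absorb(2) join_comm meet_comm)+
    then have "override_on a (p \<squnion>\<^bsub>Q\<^esub> q) S \<sqinter>\<^bsub>Q\<^esub> override_on (a \<squnion>\<^bsub>Q\<^esub> c) r S = override_on a r S"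
      using that Q by (subst meet_override_on) (auto simp del: carrier_lattice_prod)
    then show ?thesis
      using that Q by (metis (no_types) f_meet override_on_closed Q.join_closed)
  qed
  show ?thesis
    using up[of p] up[of q] down[of p] down[of q] eq by simp
qed

lemma override_on_swap: "override_on x y (- S) = override_on y x S"
  by (auto simp: override_on_def)

text \<open>The product-congruence property for the splitting into \<open>S\<close> and its
  complement, with both parts read off on slices through \<open>a\<close>. It will make the
  splitting map \<open>h\<close> of \<open>codomain_iso_slices\<close> independent of chosen
  preimages.\<close>

lemma f_eq_iff:
  assumes Q: "a \<in> carrier Q" "x \<in> carrier Q" "y \<in> carrier Q"
  shows "f x = f y \<longleftrightarrow> f (override_on a x S) = f (override_on a y S) \<and>
    f (override_on x a S) = f (override_on y a S)"
proof (intro iffI conjI)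
  assume eq: "f x = f y"
  have *: "f (override_on a x S) = f (override_on a y S)" for S
    using f_eq_transfer[of x y x a S] f_eq_override_on[OF Q(2,3) eq, of S] Q
    by (simp del: carrier_lattice_prod)
  show "f (override_on a x S) = f (override_on a y S)" by fact
  show "f (override_on x a S) = f (override_on y a S)"
    using *[of "- S"] by (simp add: override_on_swap)
next
  assume eq: "f (override_on a x S) = f (override_on a y S) \<and>
    f (override_on x a S) = f (override_on y a S)"
  \<comment> \<open>From \<open>x\<close> to \<open>y\<close> in two exchanges: the coordinates in
    \<open>S\<close> over the background \<open>x\<close>, then the remaining ones over the
    background \<open>y\<close>. Each is an equality over \<open>a\<close>, transferred.\<close>
  have "f (override_on x x S) = f (override_on x y S)"
    using eq f_eq_transfer[of x y a x S] Q by blast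
  moreover have "f (override_on x y S) = f (override_on y y S)"
    using eq f_eq_transfer[of x y a y "- S"] Q by (simp add: override_on_swap)
  ultimately show "f x = f y" by simp
qed

text \<open>Since \<open>f u \<sqsubseteq> f v\<close> means \<open>f u = f (u \<sqinter> v)\<close>
  and splicing commutes with meets, the order reduces to \<open>f_eq_iff\<close> for
  \<open>x\<close> and \<open>x \<sqinter> y\<close>.\<close>

lemma f_le_iff:
  assumes Q: "a \<in> carrier Q" "x \<in> carrier Q" "y \<in> carrier Q"
  shows "f x \<sqsubseteq>\<^bsub>B\<^esub> f y \<longleftrightarrow> f (override_on a x S) \<sqsubseteq>\<^bsub>B\<^esub> f (override_on a y S) \<and>
    f (override_on x a S) \<sqsubseteq>\<^bsub>B\<^esub> f (override_on y a S)"
proof -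
  have le: "f u \<sqsubseteq>\<^bsub>B\<^esub> f v \<longleftrightarrow> f u = f (u \<sqinter>\<^bsub>Q\<^esub> v)" if "u \<in> carrier Q" "v \<in> carrier Q" for u v
    using that B.le_iff_join f_closed f_meet by metis
  have "override_on a x S \<sqinter>\<^bsub>Q\<^esub> override_on a y S = override_on a (x \<sqinter>\<^bsub>Q\<^esub> y) S"
    "override_on x a S \<sqinter>\<^bsub>Q\<^esub> override_on y a S = override_on (x \<sqinter>\<^bsub>Q\<^esub> y) a S"
    using Q by (simp_all add: meet_override_on absorb del: carrier_lattice_prod)
  then show ?thesis
    using Q f_eq_iff[of a x "x \<sqinter>\<^bsub>Q\<^esub> y" S]
    by (simp add: le override_on_closed del: carrier_lattice_prod)
qed

text \<open>A join or meet of two points of the slice stays in the slice because \<open>a\<close> is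
  idempotent off \<open>S\<close>.\<close>

lemma lattice_slice:
  assumes "a \<in> carrier Q"
  shows "lattice (B\<lparr>carrier := (\<lambda>x. f (override_on a x S)) ` carrier Q\<rparr>)"
proof (rule sublattice)
  note [simp del] = carrier_lattice_prod
  show "lattice B" ..
  show "(\<lambda>x. f (override_on a x S)) ` carrier Q \<subseteq> carrier B"
    using assms by (auto intro: f_closed override_on_closed)
  fix u v assume "u \<in> (\<lambda>x. f (override_on a x S)) ` carrier Q" "v \<in> (\<lambda>x. f (override_on a x S)) ` carrier Q"
  then obtain x y where xy: "x \<in> carrier Q" "y \<in> carrier Q"
    "u = f (override_on a x S)" "v = f (override_on a y S)" by auto
  then show "u \<squnion>\<^bsub>B\<^esub> v \<in> (\<lambda>x. f (override_on a x S)) ` carrier Q"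
    using assms by (intro image_eqI[of _ _ "x \<squnion>\<^bsub>Q\<^esub> y"])
      (simp_all add: f_join[symmetric] override_on_closed join_override_on absorb)
  show "u \<sqinter>\<^bsub>B\<^esub> v \<in> (\<lambda>x. f (override_on a x S)) ` carrier Q"
    using xy assms by (intro image_eqI[of _ _ "x \<sqinter>\<^bsub>Q\<^esub> y"])
      (simp_all add: f_meet[symmetric] override_on_closed meet_override_on absorb)
qed

lemma codomain_iso_slices:
  assumes a: "a \<in> carrier Q" and surj: "f ` carrier Q = carrier B"
  shows "lattice_isomorphic B
    (lattice_times (B\<lparr>carrier := (\<lambda>x. f (override_on a x S)) ` carrier Q\<rparr>)
       (B\<lparr>carrier := (\<lambda>x. f (override_on a x (- S))) ` carrier Q\<rparr>))"
    (is "lattice_isomorphic B ?MN")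
proof -
  note [simp del] = carrier_lattice_prod
  define r where "r = inv_into (carrier Q) f"
  have r: "r b \<in> carrier Q" "f (r b) = b" if "b \<in> carrier B" for b
    using that surj unfolding r_def by (metis inv_into_into, metis f_inv_into_f)
  define h where "h b = (f (override_on a (r b) S), f (override_on (r b) a S))" for b
  \<comment> \<open>By \<open>f_eq_iff\<close> the chosen preimage \<open>r (f x)\<close> may be
    replaced by \<open>x\<close> itself.\<close>
  have hf: "h (f x) = (f (override_on a x S), f (override_on x a S))" if "x \<in> carrier Q" for x
    using f_eq_iff[of a "r (f x)" x S] r[of "f x"] f_closed that a by (simp add: h_def)
  have "lattice_iso B ?MN h"
  proof (rule lattice_isoI)
    show "partial_order B" ..
    show "partial_order ?MN"
      by (intro partial_order_lattice_times lattice_imp_partial_order lattice_slice a)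
    show "h ` carrier B = carrier ?MN"
    proof (intro equalityI subsetI)
      fix u assume "u \<in> h ` carrier B"
      then show "u \<in> carrier ?MN"
        using r by (auto simp: h_def lattice_times_def override_on_swap)
    next
      fix u assume "u \<in> carrier ?MN"
      then obtain x y where xy: "x \<in> carrier Q" "y \<in> carrier Q"
        "u = (f (override_on a x S), f (override_on y a S))"
        by (auto simp: lattice_times_def override_on_swap)
      \<comment> \<open>The splice has the \<open>S\<close>-part of \<open>x\<close> and the
        remaining part of \<open>y\<close>, so it realises both components of the pair at
        once.\<close>
      have "u = h (f (override_on y x S))"
        using xy a override_on_closed[OF xy(2,1), of S]
        by (simp add: hf) (simp add: override_on_def if_distrib cong: if_cong)
      then show "u \<in> h ` carrier B"
        using xy by (auto simp: f_closed override_on_closed)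
    qed
    fix b c assume "b \<in> carrier B" "c \<in> carrier B"
    then show "h b \<sqsubseteq>\<^bsub>?MN\<^esub> h c \<longleftrightarrow> b \<sqsubseteq>\<^bsub>B\<^esub> c"
      using f_le_iff[of a "r b" "r c" S] r a by (simp add: lattice_times_def h_def)
  qed
  then show ?thesis by (auto simp: lattice_isomorphic_def)
qed

lemma slice_trivial:
  assumes a: "a \<in> carrier Q" and surj: "f ` carrier Q = carrier B" and irr: "irreducible_lattice B"
  shows "(\<forall>x\<in>carrier Q. \<forall>y\<in>carrier Q. f (override_on a x S) = f (override_on a y S)) \<or>
    (\<forall>x\<in>carrier Q. \<forall>y\<in>carrier Q. f (override_on x a S) = f (override_on y a S))"
proof (rule ccontr)
  assume "\<not> ?thesis"
  then have "nontrivial_lattice (B\<lparr>carrier := (\<lambda>x. f (override_on a x S)) ` carrier Q\<rparr>)"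
    "nontrivial_lattice (B\<lparr>carrier := (\<lambda>x. f (override_on a x (- S))) ` carrier Q\<rparr>)"
    using lattice_slice[OF a, of S] lattice_slice[OF a, of "- S"]
    by (auto simp: nontrivial_lattice_def override_on_swap)
  then show False
    using irr codomain_iso_slices[OF a surj, of S] unfolding irreducible_lattice_def by blast
qed

text \<open>An irreducible image cannot split along any set of coordinates; splitting off the coordinates
  one by one leaves a single one on which the homomorphism depends.\<close>

lemma depends_on_one_coordinate:
  assumes fin: "finite K" and surj: "f ` carrier Q = carrier B" and irr: "irreducible_lattice B"
  obtains k where "k \<in> K"
    and "\<And>x y. x \<in> carrier Q \<Longrightarrow> y \<in> carrier Q \<Longrightarrow> x k = y k \<Longrightarrow> f x = f y"
proof -
  note [simp del] = carrier_lattice_prod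
  obtain b b' where b: "b \<in> carrier B" "b' \<in> carrier B" "b \<noteq> b'"
    using irr by (auto simp: irreducible_lattice_def nontrivial_lattice_def)
  then have "b \<in> f ` carrier Q" "b' \<in> f ` carrier Q"
    by (simp_all add: surj)
  then obtain a a' where a: "a \<in> carrier Q" "a' \<in> carrier Q" "f a = b" "f a' = b'"
    by (elim imageE) simp
  \<comment> \<open>With coordinate \<open>k\<close> frozen at its value in \<open>a\<close>,
    varying all others has no effect on \<open>f\<close>. If this failed for every \<open>k\<close>,
    \<open>slice_trivial\<close> would make each single coordinate ineffective, and turning
    \<open>a\<close> into \<open>a'\<close> one coordinate at a time would give
    \<open>f a = f a'\<close>.\<close>
  have "\<exists>k\<in>K. \<forall>x\<in>carrier Q. \<forall>y\<in>carrier Q. f (override_on x a {k}) = f (override_on y a {k})"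
  proof (rule ccontr)
    assume neg: "\<not> ?thesis"
    have triv: "f (override_on a x {k}) = f (override_on a y {k})"
      if "k \<in> K" "x \<in> carrier Q" "y \<in> carrier Q" for k x y
      using slice_trivial[OF a(1) surj irr, of "{k}"] neg that by blast
    have "f (override_on a a' F) = f a" if "finite F" "F \<subseteq> K" for F
      using that
    proof (induction F rule: finite_induct)
      case (insert k F)
      let ?c = "override_on a a' F"
      have c: "?c \<in> carrier Q" using a by (simp add: override_on_closed)
      have "f (override_on a a' (insert k F)) = f (override_on ?c a' {k})"
        by (auto simp: override_on_def intro!: arg_cong[of _ _ f])
      \<comment> \<open>\<open>triv\<close> speaks of the background \<open>a\<close> only; the
        transfer carries it to the partly changed point \<open>?c\<close>.\<close>
      also have "\<dots> = f (override_on ?c ?c {k})"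
        using insert.prems by (intro f_eq_transfer[of a' ?c a ?c "{k}"] triv a c) auto
      also have "\<dots> = f ?c" by simp
      finally show ?case using insert by simp
    qed simp
    from this[OF fin] have "f (override_on a a' K) = f a" by simp
    \<comment> \<open>Off \<open>K\<close> both points are \<open>undefined\<close>, so nothing of
      \<open>a\<close> survives.\<close>
    moreover have "override_on a a' K = a'"
      using a PiE_arb[of a K] PiE_arb[of a' K] by (simp add: override_on_def carrier_lattice_prod fun_eq_iff)
    ultimately show False using a b by simp
  qed
  then obtain k where k: "k \<in> K"
    "\<And>x y. x \<in> carrier Q \<Longrightarrow> y \<in> carrier Q \<Longrightarrow> f (override_on x a {k}) = f (override_on y a {k})"
    by blast
  show thesis
  proof (rule that)
    fix x y assume Q: "x \<in> carrier Q" "y \<in> carrier Q" and eq: "x k = y k"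
    have "override_on a x {k} = override_on a y {k}"
      using eq by (auto simp: override_on_def)
    then show "f x = f y"
      using k(2)[OF Q] by (simp add: f_eq_iff[OF a(1) Q, of "{k}"])
  qed (rule k)
qed

end

section \<open>Isomorphisms between products of irreducible lattices\<close>

lemma irreducible_lattice_imp_lattice: "irreducible_lattice L \<Longrightarrow> lattice L"
  by (simp add: irreducible_lattice_def nontrivial_lattice_def)

lemma irreducible_lattice_obtain:
  assumes "irreducible_lattice L"
  obtains x y where "x \<in> carrier L" "y \<in> carrier L" "x \<noteq> y"
  using assms by (auto simp: irreducible_lattice_def nontrivial_lattice_def)

lemma lattice_prod_nonempty:
  assumes "\<And>k. k \<in> K \<Longrightarrow> irreducible_lattice (A k)"
  obtains a where "a \<in> carrier (lattice_prod K A)"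
proof -
  have "carrier (A k) \<noteq> {}" if "k \<in> K" for k
    using irreducible_lattice_obtain[OF assms[OF that]] by blast
  then have "carrier (lattice_prod K A) \<noteq> {}"
    by (simp add: PiE_eq_empty_iff)
  then show thesis using that by blast
qed

lemma fun_upd_lattice_prod:
  assumes "a \<in> carrier (lattice_prod K A)" "k \<in> K" "u \<in> carrier (A k)"
  shows "a(k := u) \<in> carrier (lattice_prod K A)"
  using assms by (auto simp: PiE_iff extensional_def)

text \<open>Followed by the projection to \<open>j\<close>, the isomorphism becomes a homomorphism
  onto the irreducible lattice \<open>A' j\<close>, so \<open>depends_on_one_coordinate\<close>
  applies.\<close>

lemma lattice_iso_coordinate:
  assumes fin: "finite K"
    and irr: "\<And>k. k \<in> K \<Longrightarrow> irreducible_lattice (A k)" "\<And>j. j \<in> K' \<Longrightarrow> irreducible_lattice (A' j)"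
    and iso: "lattice_iso (lattice_prod K A) (lattice_prod K' A') \<phi>" and j: "j \<in> K'"
  obtains k where "k \<in> K"
    and "\<And>x y. x \<in> carrier (lattice_prod K A) \<Longrightarrow> y \<in> carrier (lattice_prod K A) \<Longrightarrow>
      x k = y k \<Longrightarrow> \<phi> x j = \<phi> y j"
proof -
  let ?Q = "lattice_prod K A" and ?Q' = "lattice_prod K' A'"
  note lat = irr[THEN irreducible_lattice_imp_lattice]
  have Q: "lattice ?Q" "lattice ?Q'" by (simp_all add: lattice_lattice_prod lat)
  have closed: "\<phi> x \<in> carrier ?Q'" if "x \<in> carrier ?Q" for x
    using lattice_iso_closed[OF iso that] .
  interpret lattice_prod_hom K A "A' j" "\<lambda>x. \<phi> x j"
  proof (rule lattice_prod_hom.intro)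
    fix x y assume xy: "x \<in> carrier ?Q" "y \<in> carrier ?Q"
    show "\<phi> x j \<in> carrier (A' j)" using closed[OF xy(1)] j by auto
    show "\<phi> (x \<squnion>\<^bsub>?Q\<^esub> y) j = \<phi> x j \<squnion>\<^bsub>A' j\<^esub> \<phi> y j"
      using lattice_iso_join[OF Q iso xy] lattice_prod_join[OF lat(2) closed[OF xy(1)] closed[OF xy(2)]] j
      by simp
    show "\<phi> (x \<sqinter>\<^bsub>?Q\<^esub> y) j = \<phi> x j \<sqinter>\<^bsub>A' j\<^esub> \<phi> y j"
      using lattice_iso_meet[OF Q iso xy] lattice_prod_meet[OF lat(2) closed[OF xy(1)] closed[OF xy(2)]] j
      by simp
  qed (use lat j in auto)
  have "(\<lambda>x. \<phi> x j) ` carrier ?Q = (\<lambda>y. y j) ` carrier ?Q'"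
    using bij_betw_imp_surj_on[OF lattice_iso_bij[OF iso]] image_image[of "\<lambda>y. y j" \<phi> "carrier ?Q"] by simp
  also have "\<dots> = carrier (A' j)"
  proof (intro equalityI subsetI)
    fix u assume u: "u \<in> carrier (A' j)"
    obtain b where "b \<in> carrier ?Q'" by (rule lattice_prod_nonempty[OF irr(2)])
    then have "b(j := u) \<in> carrier ?Q'" by (rule fun_upd_lattice_prod) (fact j, fact u)
    then show "u \<in> (\<lambda>y. y j) ` carrier ?Q'" by (rule image_eqI[rotated]) simp
  qed (use j in \<open>auto simp: PiE_mem\<close>)
  finally show thesis
    by (rule depends_on_one_coordinate[OF fin _ irr(2)[OF j]]) (rule that)
qed

text \<open>The coordinate of \<open>\<phi>\<close> on which each factor depends, and that of its inverse, are mutually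
  inverse bijections of the index sets.\<close>

theorem lattice_iso_prod_decomposition:
  assumes fin: "finite K" "finite K'"
    and irr: "\<And>k. k \<in> K \<Longrightarrow> irreducible_lattice (A k)" "\<And>j. j \<in> K' \<Longrightarrow> irreducible_lattice (A' j)"
    and iso: "lattice_iso (lattice_prod K A) (lattice_prod K' A') \<phi>"
  obtains \<sigma> g where "bij_betw \<sigma> K' K"
    and "\<And>j. j \<in> K' \<Longrightarrow> lattice_iso (A (\<sigma> j)) (A' j) (g j)"
    and "\<And>x j. x \<in> carrier (lattice_prod K A) \<Longrightarrow> j \<in> K' \<Longrightarrow> \<phi> x j = g j (x (\<sigma> j))"
proof -
  note [simp del] = carrier_lattice_prod
  let ?Q = "lattice_prod K A" and ?Q' = "lattice_prod K' A'"
  note lat = irr[THEN irreducible_lattice_imp_lattice]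
  define \<psi> where "\<psi> = inv_into (carrier ?Q) \<phi>"
  have iso': "lattice_iso ?Q' ?Q \<psi>"
    unfolding \<psi>_def by (rule lattice_iso_inv[OF iso])
  note \<phi>_closed = lattice_iso_closed[OF iso] and \<psi>_closed = lattice_iso_closed[OF iso']
  have \<phi>\<psi>: "\<phi> (\<psi> y) = y" if "y \<in> carrier ?Q'" for y
    using that bij_betw_inv_into_right[OF lattice_iso_bij[OF iso]] by (simp add: \<psi>_def)
  have \<psi>\<phi>: "\<psi> (\<phi> x) = x" if "x \<in> carrier ?Q" for x
    using that bij_betw_inv_into_left[OF lattice_iso_bij[OF iso]] by (simp add: \<psi>_def)
  have nth: "x k \<in> carrier (A k)" if "x \<in> carrier ?Q" "k \<in> K" for x k
    using that by (auto simp: carrier_lattice_prod)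
  have nth': "x k \<in> carrier (A' k)" if "x \<in> carrier ?Q'" "k \<in> K'" for x k
    using that by (auto simp: carrier_lattice_prod)
  have "\<forall>j\<in>K'. \<exists>k\<in>K. \<forall>x\<in>carrier ?Q. \<forall>y\<in>carrier ?Q. x k = y k \<longrightarrow> \<phi> x j = \<phi> y j"
  proof
    fix j assume "j \<in> K'"
    then obtain k where "k \<in> K" "\<And>x y. x \<in> carrier ?Q \<Longrightarrow> y \<in> carrier ?Q \<Longrightarrow> x k = y k \<Longrightarrow> \<phi> x j = \<phi> y j"
      using lattice_iso_coordinate[OF fin(1) irr iso] by blast
    then show "\<exists>k\<in>K. \<forall>x\<in>carrier ?Q. \<forall>y\<in>carrier ?Q. x k = y k \<longrightarrow> \<phi> x j = \<phi> y j" by blast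
  qed
  then obtain \<sigma> where \<sigma>: "\<And>j. j \<in> K' \<Longrightarrow> \<sigma> j \<in> K"
    "\<And>j x y. j \<in> K' \<Longrightarrow> x \<in> carrier ?Q \<Longrightarrow> y \<in> carrier ?Q \<Longrightarrow> x (\<sigma> j) = y (\<sigma> j) \<Longrightarrow> \<phi> x j = \<phi> y j"
    by metis
  have "\<forall>j\<in>K. \<exists>k\<in>K'. \<forall>x\<in>carrier ?Q'. \<forall>y\<in>carrier ?Q'. x k = y k \<longrightarrow> \<psi> x j = \<psi> y j"
  proof
    fix j assume "j \<in> K"
    then obtain k where "k \<in> K'" "\<And>x y. x \<in> carrier ?Q' \<Longrightarrow> y \<in> carrier ?Q' \<Longrightarrow> x k = y k \<Longrightarrow> \<psi> x j = \<psi> y j"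
      using lattice_iso_coordinate[OF fin(2) irr(2,1) iso'] by blast
    then show "\<exists>k\<in>K'. \<forall>x\<in>carrier ?Q'. \<forall>y\<in>carrier ?Q'. x k = y k \<longrightarrow> \<psi> x j = \<psi> y j" by blast
  qed
  then obtain \<tau> where \<tau>: "\<And>j. j \<in> K \<Longrightarrow> \<tau> j \<in> K'"
    "\<And>j x y. j \<in> K \<Longrightarrow> x \<in> carrier ?Q' \<Longrightarrow> y \<in> carrier ?Q' \<Longrightarrow> x (\<tau> j) = y (\<tau> j) \<Longrightarrow> \<psi> x j = \<psi> y j"
    by metis
  obtain a where a: "a \<in> carrier ?Q" using lattice_prod_nonempty[OF irr(1)] .
  define b where "b = \<phi> a"
  have b: "b \<in> carrier ?Q'" using \<phi>_closed a by (simp add: b_def)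
  \<comment> \<open>The factor map is obtained by varying the single entry of a base point that
    matters for entry \<open>j\<close>; by the choice of \<open>\<sigma>\<close> the rest of the
    base point is irrelevant. The map \<open>h\<close> does the same for \<open>\<psi>\<close>,
    around \<open>b = \<phi> a\<close>.\<close>
  define g where "g j u = \<phi> (a(\<sigma> j := u)) j" for j u
  define h where "h k v = \<psi> (b(\<tau> k := v)) k" for k v
  have \<phi>_eq: "\<phi> x j = g j (x (\<sigma> j))" if "x \<in> carrier ?Q" "j \<in> K'" for x j
    unfolding g_def using that by (intro \<sigma>(2) fun_upd_lattice_prod a \<sigma>(1) nth) auto
  have \<psi>_eq: "\<psi> y k = h k (y (\<tau> k))" if "y \<in> carrier ?Q'" "k \<in> K" for y k
    unfolding h_def using that by (intro \<tau>(2) fun_upd_lattice_prod b \<tau>(1) nth') auto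
  \<comment> \<open>The identity \<open>\<phi> (\<psi> y) = y\<close> read at entry
    \<open>j\<close>; \<open>hg\<close> is the other composite.\<close>
  have gh: "g j (h (\<sigma> j) (y (\<tau> (\<sigma> j)))) = y j" if "y \<in> carrier ?Q'" "j \<in> K'" for y j
    using \<phi>_eq[OF \<psi>_closed[OF that(1)] that(2)] \<psi>_eq[OF that(1) \<sigma>(1)[OF that(2)]] \<phi>\<psi>[OF that(1)] by simp
  have hg: "h k (g (\<tau> k) (x (\<sigma> (\<tau> k)))) = x k" if "x \<in> carrier ?Q" "k \<in> K" for x k
    using \<psi>_eq[OF \<phi>_closed[OF that(1)] that(2)] \<phi>_eq[OF that(1) \<tau>(1)[OF that(2)]] \<psi>\<phi>[OF that(1)] by simp
  \<comment> \<open>Otherwise the left side of \<open>gh\<close> would ignore entry \<open>j\<close>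
    of \<open>y\<close>, while the right side is that entry, and \<open>A' j\<close> has two
    distinct elements to put there.\<close>
  have \<tau>\<sigma>: "\<tau> (\<sigma> j) = j" if j: "j \<in> K'" for j
  proof (rule ccontr)
    assume neq: "\<tau> (\<sigma> j) \<noteq> j"
    obtain u v where uv: "u \<in> carrier (A' j)" "v \<in> carrier (A' j)" "u \<noteq> v"
      using irreducible_lattice_obtain[OF irr(2)[OF j]] .
    have "u = v"
      using gh[OF fun_upd_lattice_prod[OF b j uv(1)] j] gh[OF fun_upd_lattice_prod[OF b j uv(2)] j] neq
      by simp
    with uv show False by simp
  qed
  have \<sigma>\<tau>: "\<sigma> (\<tau> k) = k" if k: "k \<in> K" for k
  proof (rule ccontr)
    assume neq: "\<sigma> (\<tau> k) \<noteq> k"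
    obtain u v where uv: "u \<in> carrier (A k)" "v \<in> carrier (A k)" "u \<noteq> v"
      using irreducible_lattice_obtain[OF irr(1)[OF k]] .
    have "u = v"
      using hg[OF fun_upd_lattice_prod[OF a k uv(1)] k] hg[OF fun_upd_lattice_prod[OF a k uv(2)] k] neq
      by simp
    with uv show False by simp
  qed
  have "bij_betw \<sigma> K' K"
    by (rule bij_betw_byWitness[where f' = \<tau>]) (auto simp: \<sigma>\<tau> \<tau>\<sigma> \<sigma>(1) \<tau>(1))
  moreover have "lattice_iso (A (\<sigma> j)) (A' j) (g j)" if j: "j \<in> K'" for j
  proof (rule lattice_isoI)
    note k = \<sigma>(1)[OF j]
    have po: "partial_order (A k)" if "k \<in> K" for k
      using lat(1)[OF that] by (rule lattice_imp_partial_order)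
    have po': "partial_order (A' j)" if "j \<in> K'" for j
      using lat(2)[OF that] by (rule lattice_imp_partial_order)
    show "partial_order (A (\<sigma> j))" "partial_order (A' j)"
      using po[OF k] po'[OF j] .
    have g_closed: "g j u \<in> carrier (A' j)" if "u \<in> carrier (A (\<sigma> j))" for u
      unfolding g_def by (intro nth' \<phi>_closed fun_upd_lattice_prod a k j that)
    have h_closed: "h (\<sigma> j) v \<in> carrier (A (\<sigma> j))" if "v \<in> carrier (A' j)" for v
      unfolding h_def \<tau>\<sigma>[OF j] by (intro nth \<psi>_closed fun_upd_lattice_prod b k j that)
    have ghj: "g j (h (\<sigma> j) v) = v" if "v \<in> carrier (A' j)" for v
      using gh[OF fun_upd_lattice_prod[OF b j that] j] by (simp add: \<tau>\<sigma> j)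
    have hgj: "h (\<sigma> j) (g j u) = u" if "u \<in> carrier (A (\<sigma> j))" for u
      using hg[OF fun_upd_lattice_prod[OF a k that] k] by (simp add: \<tau>\<sigma> j)
    show "g j ` carrier (A (\<sigma> j)) = carrier (A' j)"
      using g_closed h_closed ghj by (metis image_eqI image_subsetI subsetI subset_antisym)
    fix u v assume u: "u \<in> carrier (A (\<sigma> j))" and v: "v \<in> carrier (A (\<sigma> j))"
    interpret Q: partial_order ?Q by (rule partial_order_lattice_prod) (rule po)
    interpret Q': partial_order ?Q' by (rule partial_order_lattice_prod) (rule po')
    show "g j u \<sqsubseteq>\<^bsub>A' j\<^esub> g j v \<longleftrightarrow> u \<sqsubseteq>\<^bsub>A (\<sigma> j)\<^esub> v"
    proof
      assume "u \<sqsubseteq>\<^bsub>A (\<sigma> j)\<^esub> v"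
      then have "a(\<sigma> j := u) \<sqsubseteq>\<^bsub>?Q\<^esub> a(\<sigma> j := v)"
        using Q.le_refl[OF a] by auto
      then have "\<phi> (a(\<sigma> j := u)) \<sqsubseteq>\<^bsub>?Q'\<^esub> \<phi> (a(\<sigma> j := v))"
        using lattice_iso_le_iff[OF iso fun_upd_lattice_prod[OF a k u] fun_upd_lattice_prod[OF a k v]] by blast
      then show "g j u \<sqsubseteq>\<^bsub>A' j\<^esub> g j v"
        using j by (simp add: g_def)
    next
      assume "g j u \<sqsubseteq>\<^bsub>A' j\<^esub> g j v"
      then have "b(j := g j u) \<sqsubseteq>\<^bsub>?Q'\<^esub> b(j := g j v)"
        using Q'.le_refl[OF b] by auto
      then have "\<psi> (b(j := g j u)) \<sqsubseteq>\<^bsub>?Q\<^esub> \<psi> (b(j := g j v))"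
        using lattice_iso_le_iff[OF iso' fun_upd_lattice_prod[OF b j g_closed[OF u]]
            fun_upd_lattice_prod[OF b j g_closed[OF v]]] by blast
      then have "h (\<sigma> j) (g j u) \<sqsubseteq>\<^bsub>A (\<sigma> j)\<^esub> h (\<sigma> j) (g j v)"
        using k by (simp add: h_def \<tau>\<sigma> j)
      then show "u \<sqsubseteq>\<^bsub>A (\<sigma> j)\<^esub> v"
        by (simp add: hgj u v)
    qed
  qed
  ultimately show thesis
    using \<phi>_eq by (rule that)
qed

text \<open>Converse of \<open>lattice_iso_prod_decomposition\<close>. Entry \<open>j\<close> of the
  image reads entry \<open>\<sigma> j\<close> of the argument, which is why \<open>\<sigma>\<close>
  goes from the target indices to the source indices.\<close>

lemma lattice_iso_lattice_prodI:
  assumes po: "\<And>k. k \<in> K \<Longrightarrow> partial_order (A k)" "\<And>j. j \<in> K' \<Longrightarrow> partial_order (A' j)"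
    and \<sigma>: "bij_betw \<sigma> K' K"
    and g: "\<And>j. j \<in> K' \<Longrightarrow> lattice_iso (A (\<sigma> j)) (A' j) (g j)"
  shows "lattice_iso (lattice_prod K A) (lattice_prod K' A') (\<lambda>x. \<lambda>j\<in>K'. g j (x (\<sigma> j)))"
    (is "lattice_iso ?Q ?Q' ?f")
proof (rule lattice_isoI)
  show "partial_order ?Q" "partial_order ?Q'"
    by (simp_all add: partial_order_lattice_prod po)
  have \<sigma>K: "\<sigma> j \<in> K" if "j \<in> K'" for j using \<sigma> that by (rule bij_betw_apply)
  show "?f ` carrier ?Q = carrier ?Q'"
  proof (intro equalityI subsetI)
    fix y assume "y \<in> ?f ` carrier ?Q"
    then show "y \<in> carrier ?Q'"
      by (elim imageE) (simp add: PiE_iff lattice_iso_closed[OF g] \<sigma>K)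
  next
    fix y assume y: "y \<in> carrier ?Q'"
    define \<tau> where "\<tau> = inv_into K' \<sigma>"
    have \<tau>: "\<tau> k \<in> K'" "\<sigma> (\<tau> k) = k" if "k \<in> K" for k
      using that bij_betw_apply[OF bij_betw_inv_into[OF \<sigma>]] bij_betw_inv_into_right[OF \<sigma>] by (auto simp: \<tau>_def)
    have \<tau>\<sigma>: "\<tau> (\<sigma> j) = j" if "j \<in> K'" for j
      using that bij_betw_inv_into_left[OF \<sigma>] by (simp add: \<tau>_def)
    \<comment> \<open>Solves \<open>g j (x (\<sigma> j)) = y j\<close> entry by entry, with
      \<open>j = \<tau> k\<close>.\<close>
    define x where "x = (\<lambda>k\<in>K. inv_into (carrier (A k)) (g (\<tau> k)) (y (\<tau> k)))"
    have g_img: "g j ` carrier (A (\<sigma> j)) = carrier (A' j)" if "j \<in> K'" for j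
      using lattice_iso_bij[OF g[OF that]] by (simp add: bij_betw_def)
    have "inv_into (carrier (A k)) (g (\<tau> k)) (y (\<tau> k)) \<in> carrier (A k)" if "k \<in> K" for k
      using g_img[OF \<tau>(1)[OF that]] \<tau>[OF that] y by (auto intro!: inv_into_into)
    then have x: "x \<in> carrier ?Q" by (simp add: x_def)
    have fx: "?f x = y"
    proof
      fix j show "?f x j = y j"
      proof (cases "j \<in> K'")
        case True
        then have "y j \<in> g j ` carrier (A (\<sigma> j))" using y g_img[OF True] by (simp add: PiE_iff)
        with True show ?thesis by (simp add: x_def \<sigma>K \<tau>\<sigma> f_inv_into_f)
      qed (use y in auto)
    qed
    show "y \<in> ?f ` carrier ?Q" using imageI[OF x, of ?f] by (simp only: fx)
  qed
  fix x y assume xy: "x \<in> carrier ?Q" "y \<in> carrier ?Q"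
  have "?f x \<sqsubseteq>\<^bsub>?Q'\<^esub> ?f y \<longleftrightarrow> (\<forall>j\<in>K'. x (\<sigma> j) \<sqsubseteq>\<^bsub>A (\<sigma> j)\<^esub> y (\<sigma> j))"
    using xy by (simp add: \<sigma>K PiE_iff lattice_iso_le_iff[OF g])
  also have "\<dots> \<longleftrightarrow> x \<sqsubseteq>\<^bsub>?Q\<^esub> y"
    using bij_betw_imp_surj_on[OF \<sigma>] by auto
  finally show "?f x \<sqsubseteq>\<^bsub>?Q'\<^esub> ?f y \<longleftrightarrow> x \<sqsubseteq>\<^bsub>?Q\<^esub> y" .
qed

section \<open>Automorphisms of a product\<close>

lemma Aut_iff: "\<phi> \<in> Aut L \<longleftrightarrow> \<phi> \<in> extensional (carrier L) \<and> lattice_iso L L \<phi>"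
  by (auto simp: Aut_def Bij_def lattice_iso_def)

lemma restrict_in_Aut: "lattice_iso L L \<phi> \<Longrightarrow> restrict \<phi> (carrier L) \<in> Aut L"
  by (simp add: Aut_iff lattice_iso_cong[of L "restrict \<phi> (carrier L)" \<phi>])

text \<open>Conjugation by \<open>f\<close>; the restrictions keep the conjugates
  extensional.\<close>

lemma card_of_Aut_cong:
  assumes "lattice_iso L M f"
  shows "|Aut L| =o |Aut M|"
proof -
  define g where "g = inv_into (carrier L) f"
  have iso': "lattice_iso M L g"
    unfolding g_def by (rule lattice_iso_inv[OF assms])
  note bij = lattice_iso_bij[OF assms]
  note cl = lattice_iso_closed[OF assms] lattice_iso_closed[OF iso']
  have gf: "g (f x) = x" if "x \<in> carrier L" for x
    using that bij_betw_inv_into_left[OF bij] by (simp add: g_def)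
  have fg: "f (g y) = y" if "y \<in> carrier M" for y
    using that bij_betw_inv_into_right[OF bij] by (simp add: g_def)
  let ?F = "\<lambda>\<phi>. restrict (f \<circ> (\<phi> \<circ> g)) (carrier M)"
  let ?G = "\<lambda>\<phi>. restrict (g \<circ> (\<phi> \<circ> f)) (carrier L)"
  have "bij_betw ?F (Aut L) (Aut M)"
  proof (rule bij_betw_byWitness[where f' = ?G])
    show "\<forall>\<phi>\<in>Aut L. ?G (?F \<phi>) = \<phi>"
    proof
      fix \<phi> assume "\<phi> \<in> Aut L"
      then have \<phi>: "\<phi> \<in> extensional (carrier L)" "lattice_iso L L \<phi>" by (simp_all add: Aut_iff)
      show "?G (?F \<phi>) = \<phi>"
        by (rule extensionalityI[OF _ \<phi>(1)]) (simp_all add: gf cl lattice_iso_closed[OF \<phi>(2)])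
    qed
    show "\<forall>\<phi>\<in>Aut M. ?F (?G \<phi>) = \<phi>"
    proof
      fix \<phi> assume "\<phi> \<in> Aut M"
      then have \<phi>: "\<phi> \<in> extensional (carrier M)" "lattice_iso M M \<phi>" by (simp_all add: Aut_iff)
      show "?F (?G \<phi>) = \<phi>"
        by (rule extensionalityI[OF _ \<phi>(1)]) (simp_all add: fg cl lattice_iso_closed[OF \<phi>(2)])
    qed
    show "?F ` Aut L \<subseteq> Aut M" "?G ` Aut M \<subseteq> Aut L"
      by (auto simp: Aut_iff[of _ L] Aut_iff[of _ M] intro!: restrict_in_Aut[unfolded Aut_iff, THEN conjunct2]
          lattice_iso_trans[OF lattice_iso_trans] assms iso')
  qed
  then show ?thesis using card_of_ordIsoI by blast
qed

text \<open>For each \<open>t\<close>, a permutation of the copies of \<open>L t\<close> together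
  with one automorphism per copy: the underlying set of a wreath product. Non-isomorphism of
  different \<open>L t\<close> prevents mixing of the blocks.\<close>

lemma bij_betw_Aut_lattice_prod:
  fixes L :: "'t \<Rightarrow> 'a gorder" and J :: "'t \<Rightarrow> 'j set"
  assumes fin: "finite T" "\<And>t. t \<in> T \<Longrightarrow> finite (J t)"
    and irr: "\<And>t. t \<in> T \<Longrightarrow> irreducible_lattice (L t)"
    and noniso: "\<And>s t. s \<in> T \<Longrightarrow> t \<in> T \<Longrightarrow> s \<noteq> t \<Longrightarrow> \<not> lattice_isomorphic (L s) (L t)"
  defines "K \<equiv> SIGMA t:T. J t"
  defines "Q \<equiv> lattice_prod K (\<lambda>k. L (fst k))"
  shows "bij_betw (\<lambda>F. \<lambda>x\<in>carrier Q. \<lambda>k\<in>K. snd (F (fst k)) (snd k) (x (fst k, fst (F (fst k)) (snd k))))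
    (\<Pi>\<^sub>E t\<in>T. {p. p permutes J t} \<times> (J t \<rightarrow>\<^sub>E Aut (L t))) (Aut Q)"
    (is "bij_betw ?\<Phi> ?X _")
proof -
  have K: "finite K" using fin by (auto simp: K_def)
  have irrK: "irreducible_lattice (L (fst k))" if "k \<in> K" for k
    using that irr by (auto simp: K_def)
  have poK: "partial_order (L (fst k))" if "k \<in> K" for k
    using irrK[OF that] by (intro lattice_imp_partial_order irreducible_lattice_imp_lattice)
  have perm: "fst (F t) permutes J t" and aut: "j \<in> J t \<Longrightarrow> snd (F t) j \<in> Aut (L t)"
    and ext: "snd (F t) \<in> extensional (J t)" if "F \<in> ?X" "t \<in> T" for F t j
    using PiE_mem[OF that] by (auto simp: mem_Times_iff PiE_iff)
  have mem: "?\<Phi> F \<in> Aut Q" if F: "F \<in> ?X" for F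
  proof (rule restrict_in_Aut)
    define \<sigma> where "\<sigma> = (\<lambda>k. (fst k, fst (F (fst k)) (snd k)))"
    have p: "fst (F t) j \<in> J t \<longleftrightarrow> j \<in> J t" if "t \<in> T" for t j
      using perm[OF F that] by (rule permutes_in_image)
    have "inj_on \<sigma> K"
    proof (rule inj_onI)
      fix k l assume kl: "k \<in> K" "l \<in> K" "\<sigma> k = \<sigma> l"
      then have eq: "fst k = fst l" "fst (F (fst l)) (snd k) = fst (F (fst l)) (snd l)"
        by (auto simp: \<sigma>_def)
      have "fst l \<in> T" using kl by (auto simp: K_def)
      then have "snd k = snd l"
        using eq(2) by (rule injD[OF permutes_inj[OF perm[OF F]]])
      with eq(1) show "k = l" by (rule prod_eqI)
    qed
    moreover have "\<sigma> ` K \<subseteq> K"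
      using p by (auto simp: \<sigma>_def K_def)
    ultimately have "bij_betw \<sigma> K K"
      using K by (simp add: bij_betw_def endo_inj_surj)
    then have "lattice_iso (lattice_prod K (\<lambda>k. L (fst k))) (lattice_prod K (\<lambda>k. L (fst k)))
      (\<lambda>x. \<lambda>k\<in>K. snd (F (fst k)) (snd k) (x (\<sigma> k)))"
      using poK aut[OF F] by (intro lattice_iso_lattice_prodI) (auto simp: K_def \<sigma>_def Aut_iff)
    then show "lattice_iso Q Q (\<lambda>x. \<lambda>k\<in>K. snd (F (fst k)) (snd k) (x (fst k, fst (F (fst k)) (snd k))))"
      by (simp add: Q_def \<sigma>_def)
  qed
  have inj: "F = G" if F: "F \<in> ?X" and G: "G \<in> ?X" and eq: "?\<Phi> F = ?\<Phi> G" for F G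
  proof (rule PiE_ext[OF F G])
    fix t assume t: "t \<in> T"
    have ev: "snd (F t) j (x (t, fst (F t) j)) = snd (G t) j (x (t, fst (G t) j))"
      if "x \<in> carrier Q" "j \<in> J t" for x j
      using fun_cong[OF fun_cong[OF eq, of x], of "(t, j)"] that t by (simp add: K_def)
    obtain a where a: "a \<in> carrier Q"
      unfolding Q_def by (rule lattice_prod_nonempty[OF irrK])
    have upd: "a((t, j) := u) \<in> carrier Q" if "j \<in> J t" "u \<in> carrier (L t)" for j u
      using fun_upd_lattice_prod[OF a[unfolded Q_def], of "(t, j)" u] that t by (simp add: Q_def K_def)
    have pF: "fst (F t) j \<in> J t" and pG: "fst (G t) j \<in> J t" if "j \<in> J t" for j
      using that permutes_in_image[OF perm[OF F t]] permutes_in_image[OF perm[OF G t]] by auto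
    \<comment> \<open>If the two permutations differed at \<open>j\<close>, varying the entry read
      by \<open>F\<close> would leave the value given by \<open>G\<close> fixed, contradicting
      injectivity of the automorphism that \<open>F\<close> attaches to \<open>j\<close>.\<close>
    have p: "fst (F t) j = fst (G t) j" if j: "j \<in> J t" for j
    proof (rule ccontr)
      assume neq: "fst (F t) j \<noteq> fst (G t) j"
      obtain u v where uv: "u \<in> carrier (L t)" "v \<in> carrier (L t)" "u \<noteq> v"
        using irreducible_lattice_obtain[OF irr[OF t]] .
      have "snd (F t) j u = snd (F t) j v"
        using ev[OF upd[OF pF[OF j] uv(1)] j] ev[OF upd[OF pF[OF j] uv(2)] j] neq by simp
      moreover have "inj_on (snd (F t) j) (carrier (L t))"
        using aut[OF F t j] by (simp add: Aut_iff lattice_iso_def bij_betw_def)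
      ultimately show False using uv by (simp add: inj_on_eq_iff)
    qed
    have fst_eq: "fst (F t) = fst (G t)"
    proof
      fix j show "fst (F t) j = fst (G t) j"
        using p permutes_not_in[OF perm[OF F t]] permutes_not_in[OF perm[OF G t]] by (cases "j \<in> J t") auto
    qed
    have "snd (F t) j = snd (G t) j" if j: "j \<in> J t" for j
    proof (rule extensionalityI)
      show "snd (F t) j \<in> extensional (carrier (L t))" "snd (G t) j \<in> extensional (carrier (L t))"
        using aut[OF F t j] aut[OF G t j] by (simp_all add: Aut_iff)
      fix u assume "u \<in> carrier (L t)"
      from ev[OF upd[OF pF[OF j] this] j] show "snd (F t) j u = snd (G t) j u"
        by (simp add: fst_eq)
    qed
    then have "snd (F t) = snd (G t)"
      by (rule extensionalityI[OF ext[OF F t] ext[OF G t]])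
    with fst_eq show "F t = G t" by (rule prod_eqI)
  qed
  have surj: "\<phi> \<in> ?\<Phi> ` ?X" if "\<phi> \<in> Aut Q" for \<phi>
  proof -
    have \<phi>: "\<phi> \<in> extensional (carrier Q)" "lattice_iso Q Q \<phi>" using that by (simp_all add: Aut_iff)
    obtain \<sigma> g where \<sigma>: "bij_betw \<sigma> K K"
      and g: "\<And>k. k \<in> K \<Longrightarrow> lattice_iso (L (fst (\<sigma> k))) (L (fst k)) (g k)"
      and \<phi>_eq: "\<And>x k. x \<in> carrier Q \<Longrightarrow> k \<in> K \<Longrightarrow> \<phi> x k = g k (x (\<sigma> k))"
      by (rule lattice_iso_prod_decomposition[OF K K irrK irrK \<phi>(2)[unfolded Q_def], folded Q_def])
        (assumption | rule that)+
    have \<sigma>K: "\<sigma> k \<in> K" if "k \<in> K" for k using \<sigma> that by (rule bij_betw_apply)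
    \<comment> \<open>The factor map \<open>g k\<close> is an isomorphism from
      \<open>L (fst (\<sigma> k))\<close> to \<open>L (fst k)\<close>, so the two block labels must
      agree.\<close>
    have fst_\<sigma>: "fst (\<sigma> k) = fst k" if "k \<in> K" for k
    proof (rule ccontr)
      assume "fst (\<sigma> k) \<noteq> fst k"
      moreover have "fst (\<sigma> k) \<in> T" "fst k \<in> T" using \<sigma>K[OF that] that by (auto simp: K_def)
      ultimately have "\<not> lattice_isomorphic (L (fst (\<sigma> k))) (L (fst k))" by (intro noniso)
      then show False using g[OF that] by (auto simp: lattice_isomorphic_def)
    qed
    \<comment> \<open>The value \<open>j\<close> outside \<open>J t\<close> is forced by
      \<open>permutes\<close>.\<close>
    define p where "p t j = (if j \<in> J t then snd (\<sigma> (t, j)) else j)" for t j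
    have \<sigma>_eq: "\<sigma> (t, j) = (t, p t j)" if "t \<in> T" "j \<in> J t" for t j
      using fst_\<sigma>[of "(t, j)"] that by (simp add: p_def K_def prod_eq_iff)
    have p: "p t permutes J t" if t: "t \<in> T" for t
    proof -
      have "p t ` J t \<subseteq> J t"
        using \<sigma>K \<sigma>_eq[OF t] t by (force simp: K_def)
      moreover have "inj_on (p t) (J t)"
      proof (rule inj_onI)
        fix i j assume ij: "i \<in> J t" "j \<in> J t" "p t i = p t j"
        then have "\<sigma> (t, i) = \<sigma> (t, j)" by (simp add: \<sigma>_eq t)
        with \<sigma> ij t show "i = j" by (auto simp: bij_betw_def inj_on_def K_def)
      qed
      ultimately have "bij_betw (p t) (J t) (J t)"
        using fin(2)[OF t] by (simp add: bij_betw_def endo_inj_surj)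
      then show ?thesis by (rule bij_imp_permutes) (simp add: p_def)
    qed
    define F where "F = (\<lambda>t\<in>T. (p t, \<lambda>j\<in>J t. restrict (g (t, j)) (carrier (L t))))"
    have gt: "lattice_iso (L t) (L t) (g (t, j))" if "t \<in> T" "j \<in> J t" for t j
      using g[of "(t, j)"] that by (simp add: K_def \<sigma>_eq)
    have F: "F \<in> ?X"
      using p gt by (auto simp: F_def intro!: restrict_in_Aut)
    have \<Phi>F: "?\<Phi> F = \<phi>"
    proof (rule extensionalityI[OF _ \<phi>(1)])
      fix x assume x: "x \<in> carrier Q"
      have "\<phi> x \<in> carrier Q" using lattice_iso_closed[OF \<phi>(2) x] .
      then have "\<phi> x k = undefined" if "k \<notin> K" for k using that by (auto simp: Q_def)
      moreover have "snd (F (fst k)) (snd k) (x (fst k, fst (F (fst k)) (snd k))) = \<phi> x k" if k: "k \<in> K" for k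
      proof -
        obtain t j where tj: "k = (t, j)" "t \<in> T" "j \<in> J t" using k by (auto simp: K_def)
        then have "p t j \<in> J t" using \<sigma>K[OF k] by (simp add: \<sigma>_eq K_def)
        then have "x (t, p t j) \<in> carrier (L t)" using x tj by (auto simp: Q_def K_def PiE_iff)
        then show ?thesis using \<phi>_eq[OF x k] tj by (simp add: F_def \<sigma>_eq)
      qed
      ultimately show "?\<Phi> F x = \<phi> x" using x by (auto simp: fun_eq_iff)
    qed simp
    show ?thesis using imageI[OF F, of ?\<Phi>] by (simp only: \<Phi>F)
  qed
  show ?thesis
    unfolding bij_betw_def
  proof (intro conjI equalityI subsetI inj_onI)
    show "F = G" if "F \<in> ?X" "G \<in> ?X" "?\<Phi> F = ?\<Phi> G" for F G
      using that by (rule inj)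
    show "\<phi> \<in> Aut Q" if "\<phi> \<in> ?\<Phi> ` ?X" for \<phi>
      using that mem by (elim imageE) simp
    show "\<phi> \<in> ?\<Phi> ` ?X" if "\<phi> \<in> Aut Q" for \<phi>
      using that by (rule surj)
  qed
qed

section \<open>Cardinalities\<close>

text \<open>Lets the formula for \<open>P\<close> be read off from the one for powers of
  \<open>P\<close>.\<close>

lemma lattice_power_singleton_iso:
  assumes "partial_order L"
  shows "lattice_iso L (lattice_power L {i}) (\<lambda>x. \<lambda>_\<in>{i}. x)"
proof (rule lattice_isoI)
  show "partial_order (lattice_power L {i})"
    by (simp add: lattice_power_def partial_order_lattice_prod assms)
  show "(\<lambda>x. \<lambda>_\<in>{i}. x) ` carrier L = carrier (lattice_power L {i})"
  proof (intro equalityI subsetI)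
    fix y assume y: "y \<in> carrier (lattice_power L {i})"
    have "y = (\<lambda>_\<in>{i}. y i)"
      by (rule extensionalityI[of _ "{i}"]) (use y in \<open>simp_all add: lattice_power_def PiE_iff\<close>)
    moreover have "y i \<in> carrier L" using y by (auto simp: lattice_power_def)
    ultimately show "y \<in> (\<lambda>x. \<lambda>_\<in>{i}. x) ` carrier L" by (rule image_eqI)
  qed (auto simp: lattice_power_def split: if_splits)
qed (auto simp: lattice_power_def assms)

text \<open>Entry \<open>x i t j\<close> moves to index \<open>(t, i, j)\<close>. With
  \<open>t\<close> in front, all copies of \<open>L t\<close> in the power form one block indexed by
  \<open>I \<times> E t\<close>, whose size gives the exponents of the final formula.\<close>

lemma lattice_power_lattice_prod_iso:
  fixes T :: "'t set" and L :: "'t \<Rightarrow> 'a gorder" and E :: "'t \<Rightarrow> 'j set" and I :: "'i set"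
  assumes po: "\<And>t. t \<in> T \<Longrightarrow> partial_order (L t)"
  defines "K \<equiv> SIGMA t:T. I \<times> E t"
  shows "lattice_iso (lattice_power (lattice_prod T (\<lambda>t. lattice_power (L t) (E t))) I)
    (lattice_prod K (\<lambda>k. L (fst k))) (\<lambda>x. \<lambda>k\<in>K. x (fst (snd k)) (fst k) (snd (snd k)))"
    (is "lattice_iso ?P ?Q ?f")
proof (rule lattice_isoI)
  show "partial_order ?P" "partial_order ?Q"
    using po by (auto simp: lattice_power_def K_def intro!: partial_order_lattice_prod)
  have f_closed: "?f x \<in> carrier ?Q" if "x \<in> carrier ?P" for x
    using that by (auto simp: lattice_power_def K_def PiE_iff)
  show "?f ` carrier ?P = carrier ?Q"
  proof (intro equalityI image_subsetI subsetI f_closed)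
    fix y assume y: "y \<in> carrier ?Q"
    let ?x = "\<lambda>i\<in>I. \<lambda>t\<in>T. \<lambda>j\<in>E t. y (t, i, j)"
    have x: "?x \<in> carrier ?P"
      using y by (auto simp: lattice_power_def K_def PiE_iff)
    have fx: "?f ?x = y"
      by (rule extensionalityI[of _ K]) (use y in \<open>auto simp: K_def PiE_iff\<close>)
    show "y \<in> ?f ` carrier ?P" using imageI[OF x, of ?f] by (simp only: fx)
  qed
  show "?f x \<sqsubseteq>\<^bsub>?Q\<^esub> ?f y \<longleftrightarrow> x \<sqsubseteq>\<^bsub>?P\<^esub> y" for x y
    by (auto simp: lattice_power_def K_def)
qed

section \<open>Cardinal arithmetic of the parameter sets\<close>

lemma card_of_PiE_cong:
  assumes "\<And>t. t \<in> T \<Longrightarrow> |U t| =o |V t|"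
  shows "|\<Pi>\<^sub>E t\<in>T. U t| =o |\<Pi>\<^sub>E t\<in>T. V t|"
proof -
  have "\<forall>t\<in>T. \<exists>f. bij_betw f (U t) (V t)"
    using assms by (simp add: card_of_ordIso)
  then obtain f where f: "\<And>t. t \<in> T \<Longrightarrow> bij_betw (f t) (U t) (V t)"
    by metis
  have cl: "f t x \<in> V t" if "t \<in> T" "x \<in> U t" for t x
    using f[OF that(1)] that(2) by (rule bij_betw_apply)
  have cl': "inv_into (U t) (f t) y \<in> U t" if "t \<in> T" "y \<in> V t" for t y
    using bij_betw_inv_into[OF f[OF that(1)]] that(2) by (rule bij_betw_apply)
  have "bij_betw (\<lambda>x. \<lambda>t\<in>T. f t (x t)) (\<Pi>\<^sub>E t\<in>T. U t) (\<Pi>\<^sub>E t\<in>T. V t)"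
  proof (rule bij_betw_byWitness[where f' = "\<lambda>y. \<lambda>t\<in>T. inv_into (U t) (f t) (y t)"])
    show "\<forall>x\<in>\<Pi>\<^sub>E t\<in>T. U t. (\<lambda>t\<in>T. inv_into (U t) (f t) ((\<lambda>t\<in>T. f t (x t)) t)) = x"
      using bij_betw_inv_into_left[OF f] by (auto simp: fun_eq_iff PiE_iff extensional_def)
    show "\<forall>y\<in>\<Pi>\<^sub>E t\<in>T. V t. (\<lambda>t\<in>T. f t ((\<lambda>t\<in>T. inv_into (U t) (f t) (y t)) t)) = y"
      using bij_betw_inv_into_right[OF f] by (auto simp: fun_eq_iff PiE_iff extensional_def)
  qed (auto simp: cl cl' PiE_iff)
  then show ?thesis by (rule card_of_ordIsoI)
qed

lemma card_of_PiE_Cprod: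
  assumes "\<And>t. t \<in> T \<Longrightarrow> |U t| =o r t"
  shows "|\<Pi>\<^sub>E t\<in>T. U t| =o Cprod T r"
  unfolding Cprod_def
proof (rule card_of_PiE_cong)
  fix t assume t: "t \<in> T"
  \<comment> \<open>\<open>Cprod\<close> looks only at \<open>Field (r t)\<close>; for a cardinal
    order this loses nothing.\<close>
  have "Card_order (r t)"
    using Card_order_ordIso[OF card_of_Card_order ordIso_symmetric[OF assms[OF t]]] .
  then show "|U t| =o |Field (r t)|"
    using assms[OF t] ordIso_symmetric[OF card_of_Field_ordIso] ordIso_transitive by blast
qed

lemma card_of_permutations_times_PiE:
  assumes "finite S"
  shows "|{p. p permutes S} \<times> (S \<rightarrow>\<^sub>E A)| =o fincard (fact (card S)) *c |A| ^c fincard (card S)"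
proof -
  have fin: "finite {p. p permutes S}"
    using assms by (rule finite_permutations)
  then obtain f where "bij_betw f {p. p permutes S} {..<fact (card S) :: nat}"
    using finite_same_card_bij[OF fin, of "{..<fact (card S) :: nat}"] card_permutations[OF refl assms] by auto
  then have perm: "|{p. p permutes S}| =o fincard (fact (card S))"
    by (rule card_of_ordIsoI)
  obtain g where "bij_betw g S {..<card S}"
    using finite_same_card_bij[OF assms, of "{..<card S}"] by auto
  then have "|S| =o fincard (card S)"
    by (rule card_of_ordIsoI)
  then have "|A| ^c |S| =o |A| ^c fincard (card S)"
    by (rule cexp_cong2) (auto simp: card_of_Card_order)
  \<comment> \<open>\<open>Func\<close> is the function space behind \<open>^c\<close>, and it also
    prescribes \<open>undefined\<close> outside the domain, so the two sets are equal.\<close>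
  moreover have "S \<rightarrow>\<^sub>E A = Func S A"
    by (auto simp: Func_def PiE_iff extensional_def)
  then have "|S \<rightarrow>\<^sub>E A| = |A| ^c |S|"
    by (simp add: cexp_def Field_card_of)
  ultimately have "|S \<rightarrow>\<^sub>E A| =o |A| ^c fincard (card S)"
    by simp
  from cprod_cong[OF perm this] show ?thesis
    by (simp add: cprod_def Field_card_of)
qed

lemma card_permutations_times_PiE:
  assumes "finite S"
  shows "card ({p. p permutes S} \<times> (S \<rightarrow>\<^sub>E A)) = fact (card S) * card A ^ card S"
  using assms by (simp add: card_cartesian_product card_permutations card_PiE)

text \<open>Kept as an equipotence with a concrete set of tuples, from which both the cardinal
  formula and the one in natural numbers are evaluated.\<close>

lemma card_of_Aut_lattice_power:
  assumes fin: "finite T" "\<And>t. t \<in> T \<Longrightarrow> finite (E t)" "finite I"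
    and irr: "\<And>t. t \<in> T \<Longrightarrow> irreducible_lattice (L t)"
    and noniso: "\<And>s t. s \<in> T \<Longrightarrow> t \<in> T \<Longrightarrow> s \<noteq> t \<Longrightarrow> \<not> lattice_isomorphic (L s) (L t)"
  shows "|Aut (lattice_power (lattice_prod T (\<lambda>t. lattice_power (L t) (E t))) I)| =o
    |\<Pi>\<^sub>E t\<in>T. {p. p permutes I \<times> E t} \<times> (I \<times> E t \<rightarrow>\<^sub>E Aut (L t))|"
proof -
  have "|Aut (lattice_power (lattice_prod T (\<lambda>t. lattice_power (L t) (E t))) I)| =o
    |Aut (lattice_prod (SIGMA t:T. I \<times> E t) (\<lambda>k. L (fst k)))|"
    by (intro card_of_Aut_cong[OF lattice_power_lattice_prod_iso] lattice_imp_partial_order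
        irreducible_lattice_imp_lattice irr)
  also have "|Aut (lattice_prod (SIGMA t:T. I \<times> E t) (\<lambda>k. L (fst k)))| =o
    |\<Pi>\<^sub>E t\<in>T. {p. p permutes I \<times> E t} \<times> (I \<times> E t \<rightarrow>\<^sub>E Aut (L t))|"
    by (rule ordIso_symmetric, rule card_of_ordIsoI, rule bij_betw_Aut_lattice_prod)
      (use assms in auto)
  finally show ?thesis .
qed

theorem card_of_Aut_lattice_power_Cprod:
  assumes "finite T" "\<And>t. t \<in> T \<Longrightarrow> finite (E t)" "finite I"
    and "\<And>t. t \<in> T \<Longrightarrow> irreducible_lattice (L t)"
    and "\<And>s t. s \<in> T \<Longrightarrow> t \<in> T \<Longrightarrow> s \<noteq> t \<Longrightarrow> \<not> lattice_isomorphic (L s) (L t)"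
  shows "|Aut (lattice_power (lattice_prod T (\<lambda>t. lattice_power (L t) (E t))) I)| =o
    Cprod T (\<lambda>t. fincard (fact (card (E t) * card I)) *c |Aut (L t)| ^c fincard (card (E t) * card I))"
proof (rule ordIso_transitive[OF card_of_Aut_lattice_power[OF assms] card_of_PiE_Cprod])
  fix t assume "t \<in> T"
  then have "finite (I \<times> E t)" using assms by simp
  from card_of_permutations_times_PiE[OF this, of "Aut (L t)"]
  show "|{p. p permutes I \<times> E t} \<times> (I \<times> E t \<rightarrow>\<^sub>E Aut (L t))| =o
    fincard (fact (card (E t) * card I)) *c |Aut (L t)| ^c fincard (card (E t) * card I)"
    by (simp add: card_cartesian_product mult.commute)
qed

theorem card_Aut_lattice_power:
  assumes "finite T" "\<And>t. t \<in> T \<Longrightarrow> finite (E t)" "finite I"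
    and "\<And>t. t \<in> T \<Longrightarrow> irreducible_lattice (L t)"
    and "\<And>s t. s \<in> T \<Longrightarrow> t \<in> T \<Longrightarrow> s \<noteq> t \<Longrightarrow> \<not> lattice_isomorphic (L s) (L t)"
  shows "card (Aut (lattice_power (lattice_prod T (\<lambda>t. lattice_power (L t) (E t))) I)) =
    (\<Prod>t\<in>T. fact (card (E t) * card I) * card (Aut (L t)) ^ (card (E t) * card I))"
proof -
  have "|Aut (lattice_power (lattice_prod T (\<lambda>t. lattice_power (L t) (E t))) I)| =o
    |\<Pi>\<^sub>E t\<in>T. {p. p permutes I \<times> E t} \<times> (I \<times> E t \<rightarrow>\<^sub>E Aut (L t))|"
    by (rule card_of_Aut_lattice_power) (fact assms)+
  then obtain f where "bij_betw f (Aut (lattice_power (lattice_prod T (\<lambda>t. lattice_power (L t) (E t))) I))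
    (\<Pi>\<^sub>E t\<in>T. {p. p permutes I \<times> E t} \<times> (I \<times> E t \<rightarrow>\<^sub>E Aut (L t)))"
    unfolding card_of_ordIso[symmetric] by blast
  then have "card (Aut (lattice_power (lattice_prod T (\<lambda>t. lattice_power (L t) (E t))) I)) =
    card (\<Pi>\<^sub>E t\<in>T. {p. p permutes I \<times> E t} \<times> (I \<times> E t \<rightarrow>\<^sub>E Aut (L t)))"
    by (rule bij_betw_same_card)
  also have "\<dots> = (\<Prod>t\<in>T. card ({p. p permutes I \<times> E t} \<times> (I \<times> E t \<rightarrow>\<^sub>E Aut (L t))))"
    by (rule card_PiE) (fact assms(1))
  also have "\<dots> = (\<Prod>t\<in>T. fact (card (E t) * card I) * card (Aut (L t)) ^ (card (E t) * card I))"
    by (rule prod.cong, rule refl, subst card_permutations_times_PiE)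
      (simp_all add: assms card_cartesian_product mult.commute)
  finally show ?thesis .
qed

section \<open>Residuated mappings\<close>

text \<open>Residuated mappings refer to \<open>\<bottom>\<close>, which is meaningful only if a
  least element exists; \<open>finite_lattice_bot\<close> supplies one in the application.\<close>

locale lattice_bot = lattice L + weak_partial_order_bottom L for L :: "'a gorder" (structure)

context lattice_bot
begin

lemma eq_bottomI: "b \<in> carrier L \<Longrightarrow> (\<And>x. x \<in> carrier L \<Longrightarrow> b \<sqsubseteq> x) \<Longrightarrow> b = \<bottom>"
  by (rule le_antisym) auto

lemma bottom_join [simp]: "x \<in> carrier L \<Longrightarrow> \<bottom> \<squnion> x = x"
  by (simp add: le_iff_meet[symmetric])

lemma join_assoc:
  "x \<in> carrier L \<Longrightarrow> y \<in> carrier L \<Longrightarrow> z \<in> carrier L \<Longrightarrow> (x \<squnion> y) \<squnion> z = x \<squnion> (y \<squnion> z)"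
  using weak_join_assoc[of x y z] by (simp add: eq_is_equal)

end

lemma lattice_botI:
  assumes "lattice L" "b \<in> carrier L" "\<And>x. x \<in> carrier L \<Longrightarrow> b \<sqsubseteq>\<^bsub>L\<^esub> x"
  shows "lattice_bot L"
proof -
  interpret lattice L by fact
  show ?thesis by unfold_locales (use assms in \<open>auto simp: least_def\<close>)
qed

lemma finite_lattice_bot:
  assumes "lattice L" "finite (carrier L)" "carrier L \<noteq> {}"
  shows "lattice_bot L"
proof -
  interpret lattice L by fact
  have "greatest L (\<Sqinter>\<^bsub>L\<^esub>carrier L) (Lower L (carrier L))"
    using assms by (intro finite_inf_greatest) auto
  then show ?thesis
    by (intro lattice_botI[OF assms(1), of "\<Sqinter>\<^bsub>L\<^esub>carrier L"])
      (simp_all add: greatest_closed greatest_Lower_below)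
qed

text \<open>Turns finite indexed joins into \<open>finprod\<close>, with the empty join equal to
  \<open>\<bottom>\<close>. This is the pointwise counterpart of the sums in
  \<open>Res L\<close>.\<close>

definition join_monoid :: "'a gorder \<Rightarrow> 'a monoid" where
  "join_monoid L = \<lparr>carrier = carrier L, monoid.mult = join L, one = \<bottom>\<^bsub>L\<^esub>\<rparr>"

lemma join_monoid_simps [simp]:
  "carrier (join_monoid L) = carrier L" "x \<otimes>\<^bsub>join_monoid L\<^esub> y = x \<squnion>\<^bsub>L\<^esub> y" "\<one>\<^bsub>join_monoid L\<^esub> = \<bottom>\<^bsub>L\<^esub>"
  by (simp_all add: join_monoid_def)

lemma (in lattice_bot) comm_monoid_join_monoid: "comm_monoid (join_monoid L)"
  by (rule comm_monoidI) (auto simp: join_assoc intro: join_comm)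

abbreviation Join :: "'a gorder \<Rightarrow> ('i \<Rightarrow> 'a) \<Rightarrow> 'i set \<Rightarrow> 'a" where
  "Join L \<equiv> finprod (join_monoid L)"

lemma Res_simps [simp]:
  "carrier (Res L) = residuated_maps L" "\<one>\<^bsub>Res L\<^esub> = (\<lambda>x\<in>carrier L. x)"
  "f \<otimes>\<^bsub>Res L\<^esub> g = compose (carrier L) f g" "\<zero>\<^bsub>Res L\<^esub> = (\<lambda>x\<in>carrier L. \<bottom>\<^bsub>L\<^esub>)"
  "f \<oplus>\<^bsub>Res L\<^esub> g = (\<lambda>x\<in>carrier L. f x \<squnion>\<^bsub>L\<^esub> g x)"
  by (simp_all add: Res_def)

lemma residuated_mapsI:
  assumes "f \<in> extensional (carrier L)" "\<And>x. x \<in> carrier L \<Longrightarrow> f x \<in> carrier L"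
    and "\<And>x y. x \<in> carrier L \<Longrightarrow> y \<in> carrier L \<Longrightarrow> f (x \<squnion>\<^bsub>L\<^esub> y) = f x \<squnion>\<^bsub>L\<^esub> f y"
    and "f \<bottom>\<^bsub>L\<^esub> = \<bottom>\<^bsub>L\<^esub>"
  shows "f \<in> residuated_maps L"
  using assms by (simp add: residuated_maps_def PiE_iff)

lemma residuated_mapsD:
  assumes "f \<in> residuated_maps L"
  shows "f \<in> extensional (carrier L)" "x \<in> carrier L \<Longrightarrow> f x \<in> carrier L"
    and "x \<in> carrier L \<Longrightarrow> y \<in> carrier L \<Longrightarrow> f (x \<squnion>\<^bsub>L\<^esub> y) = f x \<squnion>\<^bsub>L\<^esub> f y"
    and "f \<bottom>\<^bsub>L\<^esub> = \<bottom>\<^bsub>L\<^esub>"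
  using assms by (simp_all add: residuated_maps_def PiE_iff)

context lattice_bot
begin

sublocale J: comm_monoid "join_monoid L"
  rewrites "carrier (join_monoid L) = carrier L" and "monoid.mult (join_monoid L) = join L"
    and "monoid.one (join_monoid L) = \<bottom>"
  by (rule comm_monoid_join_monoid) (simp_all add: join_monoid_def)

lemma id_residuated: "(\<lambda>x\<in>carrier L. x) \<in> residuated_maps L"
  by (rule residuated_mapsI) simp_all

lemma zero_residuated: "(\<lambda>x\<in>carrier L. \<bottom>) \<in> residuated_maps L"
  by (rule residuated_mapsI) simp_all

lemma compose_residuated:
  "f \<in> residuated_maps L \<Longrightarrow> g \<in> residuated_maps L \<Longrightarrow> compose (carrier L) f g \<in> residuated_maps L"
  by (rule residuated_mapsI) (simp_all add: compose_def residuated_mapsD)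

lemma join_residuated:
  "f \<in> residuated_maps L \<Longrightarrow> g \<in> residuated_maps L \<Longrightarrow> (\<lambda>x\<in>carrier L. f x \<squnion> g x) \<in> residuated_maps L"
  by (rule residuated_mapsI) (simp_all add: residuated_mapsD J.m_ac)

lemma abelian_monoid_Res: "abelian_monoid (Res L)"
proof (rule abelian_monoidI)
  fix f assume "f \<in> carrier (Res L)"
  then have f: "f \<in> residuated_maps L" by simp
  show "\<zero>\<^bsub>Res L\<^esub> \<oplus>\<^bsub>Res L\<^esub> f = f"
    by (rule extensionalityI[OF _ residuated_mapsD(1)[OF f]]) (simp_all add: residuated_mapsD(2)[OF f])
qed (auto simp: zero_residuated join_residuated residuated_mapsD J.m_ac intro!: restrict_ext)

text \<open>Evaluation at \<open>x\<close> respects sums; this computes the entries of a matrix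
  product.\<close>

lemma finsum_Res:
  assumes "finite F" "\<And>k. k \<in> F \<Longrightarrow> h k \<in> residuated_maps L" "x \<in> carrier L"
  shows "(\<Oplus>\<^bsub>Res L\<^esub>k\<in>F. h k) x = Join L (\<lambda>k. h k x) F"
proof -
  interpret R: abelian_monoid "Res L" by (rule abelian_monoid_Res)
  show ?thesis
    using assms(1,2)
  proof (induction F rule: finite_induct)
    case (insert k F)
    then show ?case
      using assms(3) by (simp add: Pi_iff residuated_mapsD)
  qed (use assms(3) in simp)
qed

lemma residuated_Join:
  assumes "\<phi> \<in> residuated_maps L" "finite F" "\<And>k. k \<in> F \<Longrightarrow> h k \<in> carrier L"
  shows "\<phi> (Join L h F) = Join L (\<lambda>k. \<phi> (h k)) F"
  using assms(2,3)
proof (induction F rule: finite_induct)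
  case (insert k F)
  then show ?case
    using assms(1) by (simp add: Pi_iff residuated_mapsD)
qed (use assms(1) in \<open>simp add: residuated_mapsD\<close>)

text \<open>Join-preserving maps are monotone, so a residuated inverse makes \<open>f\<close>
  reflect the order; conversely an order automorphism preserves joins and \<open>\<bottom>\<close>.
  The sets are equal, not merely equipotent, because both consist of extensional maps.\<close>

lemma Units_Res: "Units (Res L) = Aut L"
proof (intro equalityI subsetI)
  fix f assume "f \<in> Units (Res L)"
  then obtain g where f: "f \<in> residuated_maps L" and g: "g \<in> residuated_maps L"
    and fg: "compose (carrier L) f g = (\<lambda>x\<in>carrier L. x)"
    and gf: "compose (carrier L) g f = (\<lambda>x\<in>carrier L. x)"
    by (auto simp: Units_def)
  have f_g: "f (g x) = x" and g_f: "g (f x) = x" if "x \<in> carrier L" for x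
    using fun_cong[OF fg, of x] fun_cong[OF gf, of x] that by (simp_all add: compose_def)
  note cl = residuated_mapsD(2)[OF f] residuated_mapsD(2)[OF g]
  have mono: "h x \<sqsubseteq> h y" if "h \<in> residuated_maps L" "x \<in> carrier L" "y \<in> carrier L" "x \<sqsubseteq> y" for h x y
    using that residuated_mapsD(3)[of h L x y] by (simp add: le_iff_meet residuated_mapsD)
  have "lattice_iso L L f"
  proof (rule lattice_isoI)
    show "partial_order L" ..
    then show "partial_order L" .
    have "x \<in> f ` carrier L" if "x \<in> carrier L" for x
      using imageI[OF cl(2)[OF that], of f] by (simp only: f_g[OF that])
    then show "f ` carrier L = carrier L" using cl(1) by auto
    show "f x \<sqsubseteq> f y \<longleftrightarrow> x \<sqsubseteq> y" if "x \<in> carrier L" "y \<in> carrier L" for x y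
      using mono[OF f that] mono[OF g cl(1) cl(1), OF that] that by (auto simp: g_f)
  qed
  then show "f \<in> Aut L" using residuated_mapsD(1)[OF f] by (simp add: Aut_iff)
next
  have res: "f \<in> residuated_maps L" if "f \<in> Aut L" for f
  proof -
    have f: "f \<in> extensional (carrier L)" "lattice_iso L L f" using that by (simp_all add: Aut_iff)
    note cl = lattice_iso_closed[OF f(2)]
    \<comment> \<open>Every element is some \<open>f x\<close>, and \<open>f \<bottom>\<close> lies
      below each of these.\<close>
    have "f \<bottom> = \<bottom>"
    proof (rule eq_bottomI)
      fix x assume "x \<in> carrier L"
      then have "x \<in> f ` carrier L"
        using bij_betw_imp_surj_on[OF lattice_iso_bij[OF f(2)]] by simp
      then show "f \<bottom> \<sqsubseteq> x" by (elim imageE) (simp add: lattice_iso_le_iff[OF f(2)])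
    qed (simp add: cl)
    then show ?thesis
      using f(1) cl lattice_iso_join[OF lattice_axioms lattice_axioms f(2)] by (intro residuated_mapsI)
  qed
  fix f assume f: "f \<in> Aut L"
  then have iso: "lattice_iso L L f" by (simp add: Aut_iff)
  define g where "g = restrict (inv_into (carrier L) f) (carrier L)"
  have "g \<in> Aut L"
    unfolding g_def by (rule restrict_in_Aut[OF lattice_iso_inv[OF iso]])
  moreover have "compose (carrier L) f g = (\<lambda>x\<in>carrier L. x)"
    using bij_betw_inv_into_right[OF lattice_iso_bij[OF iso]] by (auto simp: compose_def g_def)
  moreover have "compose (carrier L) g f = (\<lambda>x\<in>carrier L. x)"
    using bij_betw_inv_into_left[OF lattice_iso_bij[OF iso]] lattice_iso_closed[OF iso]
    by (auto simp: compose_def g_def)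
  ultimately show "f \<in> Units (Res L)"
    using f by (auto simp: Units_def intro!: res)
qed

end

text \<open>\<open>Units\<close> unfolds to equations between products and the one, which an
  injective map respecting both preserves and reflects. Closure of \<open>G\<close> is what lets
  injectivity be applied to the products.\<close>

lemma bij_betw_Units:
  assumes bij: "bij_betw h (carrier G) (carrier H)"
    and mult: "\<And>x y. x \<in> carrier G \<Longrightarrow> y \<in> carrier G \<Longrightarrow> h (x \<otimes>\<^bsub>G\<^esub> y) = h x \<otimes>\<^bsub>H\<^esub> h y"
    and one: "h \<one>\<^bsub>G\<^esub> = \<one>\<^bsub>H\<^esub>" "\<one>\<^bsub>G\<^esub> \<in> carrier G"
    and closed: "\<And>x y. x \<in> carrier G \<Longrightarrow> y \<in> carrier G \<Longrightarrow> x \<otimes>\<^bsub>G\<^esub> y \<in> carrier G"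
  shows "bij_betw h (Units G) (Units H)"
proof (rule bij_betw_subset[OF bij])
  have inj: "h x = h y \<longleftrightarrow> x = y" if "x \<in> carrier G" "y \<in> carrier G" for x y
    using bij that by (auto simp: bij_betw_def inj_on_eq_iff)
  have unit: "h x \<otimes>\<^bsub>H\<^esub> h y = \<one>\<^bsub>H\<^esub> \<longleftrightarrow> x \<otimes>\<^bsub>G\<^esub> y = \<one>\<^bsub>G\<^esub>" if "x \<in> carrier G" "y \<in> carrier G" for x y
    using inj[OF closed[OF that] one(2)] by (simp add: mult[OF that] one(1))
  have surj: "h ` carrier G = carrier H" using bij by (rule bij_betw_imp_surj_on)
  have iff: "h x \<in> Units H \<longleftrightarrow> x \<in> Units G" if "x \<in> carrier G" for x
    using that by (simp add: Units_def unit flip: surj)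
  then have "h ` Units G \<subseteq> Units H" by (auto simp: Units_def)
  moreover have "y \<in> h ` Units G" if y: "y \<in> Units H" for y
  proof -
    have "y \<in> h ` carrier G" using y surj by (simp add: Units_def)
    then obtain x where x: "x \<in> carrier G" "y = h x" by blast
    then have "x \<in> Units G" using iff[OF x(1)] y by simp
    then show ?thesis using x(2) by (rule rev_image_eqI)
  qed
  ultimately show "h ` Units G = Units H" by (intro equalityI subsetI) auto
qed (auto simp: Units_def)

section \<open>Matrices of residuated mappings\<close>

text \<open>The \<open>j\<close>-th coordinate embedding of \<open>L\<close> into its power, in the
  role of a basis vector scaled by \<open>x\<close>.\<close>

definition insert_coord :: "'a gorder \<Rightarrow> 'i set \<Rightarrow> 'i \<Rightarrow> 'a \<Rightarrow> 'i \<Rightarrow> 'a" where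
  "insert_coord L I j x = (\<lambda>i\<in>I. if i = j then x else \<bottom>\<^bsub>L\<^esub>)"

text \<open>As for linear maps, column \<open>j\<close> records the image of the \<open>j\<close>-th
  coordinate embedding.\<close>

definition map_to_matrix :: "'a gorder \<Rightarrow> 'i set \<Rightarrow> (('i \<Rightarrow> 'a) \<Rightarrow> 'i \<Rightarrow> 'a) \<Rightarrow> 'i \<times> 'i \<Rightarrow> 'a \<Rightarrow> 'a" where
  "map_to_matrix L I \<phi> = (\<lambda>(i, j)\<in>I \<times> I. \<lambda>x\<in>carrier L. \<phi> (insert_coord L I j x) i)"

text \<open>Matrix times column vector, with join as the sum.\<close>

definition matrix_to_map :: "'a gorder \<Rightarrow> 'i set \<Rightarrow> ('i \<times> 'i \<Rightarrow> 'a \<Rightarrow> 'a) \<Rightarrow> ('i \<Rightarrow> 'a) \<Rightarrow> 'i \<Rightarrow> 'a" where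
  "matrix_to_map L I F = (\<lambda>y\<in>carrier (lattice_power L I). \<lambda>i\<in>I. Join L (\<lambda>k. F (i, k) (y k)) I)"

lemma Mat_simps [simp]:
  "carrier (Mat I R) = I \<times> I \<rightarrow>\<^sub>E carrier R"
  "f \<otimes>\<^bsub>Mat I R\<^esub> g = (\<lambda>(i, j)\<in>I \<times> I. \<Oplus>\<^bsub>R\<^esub>k\<in>I. f (i, k) \<otimes>\<^bsub>R\<^esub> g (k, j))"
  "\<one>\<^bsub>Mat I R\<^esub> = (\<lambda>(i, j)\<in>I \<times> I. if i = j then \<one>\<^bsub>R\<^esub> else \<zero>\<^bsub>R\<^esub>)"
  by (simp_all add: Mat_def)

section \<open>Powers of a lattice with least element and the action of matrices on them\<close>

context lattice_bot
begin

lemma carrier_lattice_power: "carrier (lattice_power L I) = I \<rightarrow>\<^sub>E carrier L"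
  by (simp add: lattice_power_def)

lemma join_lattice_power:
  "x \<in> I \<rightarrow>\<^sub>E carrier L \<Longrightarrow> y \<in> I \<rightarrow>\<^sub>E carrier L \<Longrightarrow> x \<squnion>\<^bsub>lattice_power L I\<^esub> y = (\<lambda>i\<in>I. x i \<squnion> y i)"
  using lattice_prod_join[of I "\<lambda>_. L" x y] lattice_axioms by (simp add: lattice_power_def)

lemma lattice_bot_lattice_power: "lattice_bot (lattice_power L I)"
  by (rule lattice_botI[of _ "\<lambda>i\<in>I. \<bottom>"])
    (auto simp: lattice_power_def lattice_lattice_prod lattice_axioms)

lemma bottom_lattice_power: "\<bottom>\<^bsub>lattice_power L I\<^esub> = (\<lambda>i\<in>I. \<bottom>)"
  by (rule lattice_bot.eq_bottomI[OF lattice_bot_lattice_power, symmetric])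
    (auto simp: lattice_power_def)

lemma Join_lattice_power:
  assumes "finite F" "\<And>k. k \<in> F \<Longrightarrow> y k \<in> I \<rightarrow>\<^sub>E carrier L"
  shows "Join (lattice_power L I) y F = (\<lambda>i\<in>I. Join L (\<lambda>k. y k i) F)"
proof -
  interpret Q: lattice_bot "lattice_power L I" by (rule lattice_bot_lattice_power)
  show ?thesis
    using assms
  proof (induction F rule: finite_induct)
    case (insert k F)
    have yk: "y k \<in> I \<rightarrow>\<^sub>E carrier L"
      using insert.prems by simp
    have JF: "(\<lambda>i\<in>I. Join L (\<lambda>k. y k i) F) \<in> I \<rightarrow>\<^sub>E carrier L"
      using insert.prems by (auto intro!: J.finprod_closed)
    have "Join (lattice_power L I) y (insert k F) =
        y k \<squnion>\<^bsub>lattice_power L I\<^esub> Join (lattice_power L I) y F"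
      using insert.hyps insert.prems by (intro Q.J.finprod_insert) (auto simp: carrier_lattice_power)
    also have "\<dots> = y k \<squnion>\<^bsub>lattice_power L I\<^esub> (\<lambda>i\<in>I. Join L (\<lambda>k. y k i) F)"
    proof -
      have "Join (lattice_power L I) y F = (\<lambda>i\<in>I. Join L (\<lambda>k. y k i) F)"
        by (rule insert.IH) (use insert.prems in simp)
      then show ?thesis by (simp only:)
    qed
    also have "\<dots> = (\<lambda>i\<in>I. y k i \<squnion> (\<lambda>i\<in>I. Join L (\<lambda>k. y k i) F) i)"
      by (rule join_lattice_power[OF yk JF])
    also have "\<dots> = (\<lambda>i\<in>I. Join L (\<lambda>k. y k i) (insert k F))"
    proof (rule restrict_ext)
      fix i assume "i \<in> I"
      then show "y k i \<squnion> (\<lambda>i\<in>I. Join L (\<lambda>k. y k i) F) i = Join L (\<lambda>k. y k i) (insert k F)"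
        using insert.hyps insert.prems by (simp, intro J.finprod_insert[symmetric]) auto
    qed
    finally show ?case .
  qed (simp add: bottom_lattice_power)
qed

lemma insert_coord_closed: "x \<in> carrier L \<Longrightarrow> insert_coord L I j x \<in> I \<rightarrow>\<^sub>E carrier L"
  by (auto simp: insert_coord_def)

text \<open>Expansion of a vector along the coordinate embeddings: at entry \<open>i\<close> all
  contributions with \<open>k \<noteq> i\<close> are \<open>\<bottom>\<close>.\<close>

lemma Join_insert_coord:
  assumes "finite I" "y \<in> I \<rightarrow>\<^sub>E carrier L"
  shows "Join (lattice_power L I) (\<lambda>k. insert_coord L I k (y k)) I = y"
proof (rule extensionalityI)
  fix i assume i: "i \<in> I"
  have "Join (lattice_power L I) (\<lambda>k. insert_coord L I k (y k)) I i = Join L (\<lambda>k. insert_coord L I k (y k) i) I"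
    using assms i by (subst Join_lattice_power) (auto intro!: insert_coord_closed)
  also have "\<dots> = Join L (\<lambda>k. if i = k then y k else \<bottom>) I"
    using i by (simp add: insert_coord_def)
  also have "\<dots> = y i"
    using i assms by (intro J.finprod_singleton) auto
  finally show "Join (lattice_power L I) (\<lambda>k. insert_coord L I k (y k)) I i = y i" .
next
  show "Join (lattice_power L I) (\<lambda>k. insert_coord L I k (y k)) I \<in> extensional I"
    using assms by (subst Join_lattice_power) (auto intro!: insert_coord_closed)
qed (use assms in \<open>simp add: PiE_iff\<close>)

text \<open>Applying \<open>\<phi>\<close> to the expansion in \<open>Join_insert_coord\<close>
  shows that \<open>\<phi>\<close> acts through its own matrix. Both the recovery of
  \<open>\<phi>\<close> from the matrix and multiplicativity rest on this.\<close>

lemma residuated_eq_Join: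
  assumes "finite I" "\<phi> \<in> residuated_maps (lattice_power L I)" "y \<in> I \<rightarrow>\<^sub>E carrier L" "i \<in> I"
  shows "\<phi> y i = Join L (\<lambda>k. \<phi> (insert_coord L I k (y k)) i) I"
proof -
  interpret Q: lattice_bot "lattice_power L I" by (rule lattice_bot_lattice_power)
  have cl: "insert_coord L I k (y k) \<in> carrier (lattice_power L I)" if "k \<in> I" for k
    using assms(3) that by (auto simp: carrier_lattice_power intro!: insert_coord_closed)
  have "\<phi> y = \<phi> (Join (lattice_power L I) (\<lambda>k. insert_coord L I k (y k)) I)"
    by (simp add: Join_insert_coord assms)
  also have "\<dots> = Join (lattice_power L I) (\<lambda>k. \<phi> (insert_coord L I k (y k))) I"
    by (rule Q.residuated_Join) (use assms cl in auto)
  also have "\<dots> = (\<lambda>i\<in>I. Join L (\<lambda>k. \<phi> (insert_coord L I k (y k)) i) I)"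
    by (rule Join_lattice_power)
      (use assms residuated_mapsD(2)[OF assms(2) cl] in \<open>simp_all add: carrier_lattice_power\<close>)
  finally show ?thesis using assms(4) by simp
qed

lemma map_to_matrix_apply:
  "i \<in> I \<Longrightarrow> j \<in> I \<Longrightarrow> x \<in> carrier L \<Longrightarrow> map_to_matrix L I \<phi> (i, j) x = \<phi> (insert_coord L I j x) i"
  by (simp add: map_to_matrix_def)

text \<open>Each entry is the \<open>j\<close>-th embedding, then \<open>\<phi>\<close>, then the
  \<open>i\<close>-th projection, and all three preserve joins and least elements.\<close>

lemma map_to_matrix_closed:
  assumes \<phi>: "\<phi> \<in> residuated_maps (lattice_power L I)"
  shows "map_to_matrix L I \<phi> \<in> carrier (Mat I (Res L))"
proof -
  have closed: "\<phi> (insert_coord L I j x) \<in> I \<rightarrow>\<^sub>E carrier L" if "x \<in> carrier L" for j x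
    using residuated_mapsD(2)[OF \<phi>, unfolded carrier_lattice_power] insert_coord_closed[OF that] .
  have "(\<lambda>x\<in>carrier L. \<phi> (insert_coord L I j x) i) \<in> residuated_maps L" if ij: "i \<in> I" "j \<in> I" for i j
  proof (rule residuated_mapsI)
    fix x y assume xy: "x \<in> carrier L" "y \<in> carrier L"
    have "insert_coord L I j (x \<squnion> y) =
        insert_coord L I j x \<squnion>\<^bsub>lattice_power L I\<^esub> insert_coord L I j y"
      unfolding join_lattice_power[OF insert_coord_closed[OF xy(1)] insert_coord_closed[OF xy(2)]]
      by (auto simp: insert_coord_def fun_eq_iff)
    then have "\<phi> (insert_coord L I j (x \<squnion> y)) =
        \<phi> (insert_coord L I j x) \<squnion>\<^bsub>lattice_power L I\<^esub> \<phi> (insert_coord L I j y)"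
      using residuated_mapsD(3)[OF \<phi>, unfolded carrier_lattice_power] xy
      by (simp add: insert_coord_closed)
    then show "(\<lambda>x\<in>carrier L. \<phi> (insert_coord L I j x) i) (x \<squnion> y) =
        (\<lambda>x\<in>carrier L. \<phi> (insert_coord L I j x) i) x \<squnion> (\<lambda>x\<in>carrier L. \<phi> (insert_coord L I j x) i) y"
      using xy ij by (simp add: join_lattice_power closed)
  next
    fix x assume "x \<in> carrier L"
    then show "(\<lambda>x\<in>carrier L. \<phi> (insert_coord L I j x) i) x \<in> carrier L"
      using closed[of x j] ij by (simp add: PiE_iff)
  next
    have "insert_coord L I j \<bottom> = \<bottom>\<^bsub>lattice_power L I\<^esub>"
      by (simp add: insert_coord_def bottom_lattice_power cong: restrict_cong)
    then show "(\<lambda>x\<in>carrier L. \<phi> (insert_coord L I j x) i) \<bottom> = \<bottom>"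
      using ij by (simp add: residuated_mapsD(4)[OF \<phi>]) (simp add: bottom_lattice_power)
  qed simp
  then show ?thesis
    by (auto simp: map_to_matrix_def)
qed

lemma matrix_to_map_closed:
  assumes "finite I" "F \<in> carrier (Mat I (Res L))"
  shows "matrix_to_map L I F \<in> residuated_maps (lattice_power L I)"
proof -
  have F: "F (i, k) \<in> residuated_maps L" if "i \<in> I" "k \<in> I" for i k
    using assms(2) that by (auto simp: PiE_iff)
  have cl: "F (i, k) (y k) \<in> carrier L" if "i \<in> I" "k \<in> I" "y \<in> I \<rightarrow>\<^sub>E carrier L" for i k y
    using residuated_mapsD(2)[OF F[OF that(1,2)]] that(2,3) by (auto simp: PiE_iff)
  have img: "(\<lambda>i\<in>I. Join L (\<lambda>k. F (i, k) (y k)) I) \<in> I \<rightarrow>\<^sub>E carrier L" if "y \<in> I \<rightarrow>\<^sub>E carrier L" for y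
    using that by (auto intro!: J.finprod_closed cl)
  have matrix_to_map_eq: "matrix_to_map L I F y = (\<lambda>i\<in>I. Join L (\<lambda>k. F (i, k) (y k)) I)"
    if "y \<in> I \<rightarrow>\<^sub>E carrier L" for y
    using that by (simp add: matrix_to_map_def carrier_lattice_power)
  show ?thesis
  proof (rule residuated_mapsI)
    fix x y assume xy: "x \<in> carrier (lattice_power L I)" "y \<in> carrier (lattice_power L I)"
    then have xy': "x \<in> I \<rightarrow>\<^sub>E carrier L" "y \<in> I \<rightarrow>\<^sub>E carrier L" by (simp_all add: carrier_lattice_power)
    have joinxy: "(\<lambda>i\<in>I. x i \<squnion> y i) \<in> I \<rightarrow>\<^sub>E carrier L" using xy' by (auto simp: PiE_iff)
    have "Join L (\<lambda>k. F (i, k) ((\<lambda>i\<in>I. x i \<squnion> y i) k)) I =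
        Join L (\<lambda>k. F (i, k) (x k)) I \<squnion> Join L (\<lambda>k. F (i, k) (y k)) I" if i: "i \<in> I" for i
    proof -
      have "Join L (\<lambda>k. F (i, k) ((\<lambda>i\<in>I. x i \<squnion> y i) k)) I = Join L (\<lambda>k. F (i, k) (x k) \<squnion> F (i, k) (y k)) I"
        using i cl[OF i _ xy'(1)] cl[OF i _ xy'(2)] xy'
        by (intro J.finprod_cong') (auto simp: PiE_iff residuated_mapsD(3)[OF F] intro!: J.m_closed)
      also have "\<dots> = Join L (\<lambda>k. F (i, k) (x k)) I \<squnion> Join L (\<lambda>k. F (i, k) (y k)) I"
        using xy' i by (intro J.finprod_multf) (auto intro!: cl)
      finally show ?thesis .
    qed
    then show "matrix_to_map L I F (x \<squnion>\<^bsub>lattice_power L I\<^esub> y) =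
        matrix_to_map L I F x \<squnion>\<^bsub>lattice_power L I\<^esub> matrix_to_map L I F y"
      unfolding join_lattice_power[OF xy'] matrix_to_map_eq[OF joinxy] matrix_to_map_eq[OF xy'(1)]
        matrix_to_map_eq[OF xy'(2)] join_lattice_power[OF img[OF xy'(1)] img[OF xy'(2)]]
      by (intro restrict_ext) simp
  next
    have "Join L (\<lambda>k. F (i, k) ((\<lambda>i\<in>I. \<bottom>) k)) I = \<bottom>" if "i \<in> I" for i
      using that by (intro J.finprod_one_eqI) (simp add: residuated_mapsD(4)[OF F])
    then show "matrix_to_map L I F \<bottom>\<^bsub>lattice_power L I\<^esub> = \<bottom>\<^bsub>lattice_power L I\<^esub>"
      by (simp add: matrix_to_map_def bottom_lattice_power carrier_lattice_power cong: restrict_cong)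
  next
    fix y assume "y \<in> carrier (lattice_power L I)"
    then show "matrix_to_map L I F y \<in> carrier (lattice_power L I)"
      using img by (simp only: matrix_to_map_eq carrier_lattice_power)
  qed (simp add: matrix_to_map_def)
qed

lemma bij_betw_map_to_matrix:
  assumes fin: "finite I"
  shows "bij_betw (map_to_matrix L I) (carrier (Res (lattice_power L I))) (carrier (Mat I (Res L)))"
proof (rule bij_betw_byWitness[where f' = "matrix_to_map L I"])
  show "\<forall>\<phi>\<in>carrier (Res (lattice_power L I)). matrix_to_map L I (map_to_matrix L I \<phi>) = \<phi>"
  proof
    fix \<phi> assume "\<phi> \<in> carrier (Res (lattice_power L I))"
    then have \<phi>: "\<phi> \<in> residuated_maps (lattice_power L I)" by simp
    show "matrix_to_map L I (map_to_matrix L I \<phi>) = \<phi>"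
    proof (rule extensionalityI[OF _ residuated_mapsD(1)[OF \<phi>]])
      fix y assume "y \<in> carrier (lattice_power L I)"
      then have y: "y \<in> I \<rightarrow>\<^sub>E carrier L" by (simp add: carrier_lattice_power)
      have \<phi>y: "\<phi> x \<in> I \<rightarrow>\<^sub>E carrier L" if "x \<in> I \<rightarrow>\<^sub>E carrier L" for x
        using residuated_mapsD(2)[OF \<phi>] that by (simp add: carrier_lattice_power)
      show "matrix_to_map L I (map_to_matrix L I \<phi>) y = \<phi> y"
      proof (rule extensionalityI[of _ I])
        fix i assume i: "i \<in> I"
        have "Join L (\<lambda>k. map_to_matrix L I \<phi> (i, k) (y k)) I = Join L (\<lambda>k. \<phi> (insert_coord L I k (y k)) i) I"
          using i y \<phi>y[OF insert_coord_closed]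
          by (intro J.finprod_cong') (auto simp: PiE_iff map_to_matrix_apply)
        then show "matrix_to_map L I (map_to_matrix L I \<phi>) y i = \<phi> y i"
          using i y by (simp add: residuated_eq_Join[OF fin \<phi> y i] matrix_to_map_def carrier_lattice_power)
      qed (use y \<phi>y[OF y] in \<open>auto simp: matrix_to_map_def carrier_lattice_power PiE_iff\<close>)
    qed (simp add: matrix_to_map_def)
  qed
  show "\<forall>F\<in>carrier (Mat I (Res L)). map_to_matrix L I (matrix_to_map L I F) = F"
  proof
    fix F assume "F \<in> carrier (Mat I (Res L))"
    then have F: "F \<in> extensional (I \<times> I)" "\<And>i j. i \<in> I \<Longrightarrow> j \<in> I \<Longrightarrow> F (i, j) \<in> residuated_maps L"
      by (auto simp: PiE_iff)
    show "map_to_matrix L I (matrix_to_map L I F) = F"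
    proof (rule extensionalityI[OF _ F(1)])
      fix p assume "p \<in> I \<times> I"
      then obtain i j where p: "p = (i, j)" and ij: "i \<in> I" "j \<in> I" by auto
      show "map_to_matrix L I (matrix_to_map L I F) p = F p"
        unfolding p
      proof (rule extensionalityI[OF _ residuated_mapsD(1)[OF F(2)[OF ij]]])
        fix x assume x: "x \<in> carrier L"
        have "matrix_to_map L I F (insert_coord L I j x) i = Join L (\<lambda>k. F (i, k) (insert_coord L I j x k)) I"
          using x ij by (simp add: matrix_to_map_def insert_coord_closed carrier_lattice_power)
        \<comment> \<open>For \<open>k \<noteq> j\<close> the vector has entry
          \<open>\<bottom>\<close>, and \<open>F (i, k) \<bottom> = \<bottom>\<close>, so only one
          summand is left.\<close>
        also have "\<dots> = Join L (\<lambda>k. if j = k then F (i, k) x else \<bottom>) I"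
          using x ij residuated_mapsD[OF F(2)[OF ij(1)]]
          by (intro J.finprod_cong') (auto simp: insert_coord_def)
        also have "\<dots> = F (i, j) x"
          using x ij fin residuated_mapsD(2)[OF F(2)[OF ij(1)]] by (intro J.finprod_singleton) auto
        finally show "map_to_matrix L I (matrix_to_map L I F) (i, j) x = F (i, j) x"
          using x ij by (simp add: map_to_matrix_apply)
      qed (use ij in \<open>simp add: map_to_matrix_def\<close>)
    qed (simp add: map_to_matrix_def)
  qed
qed (auto simp del: Mat_simps intro!: map_to_matrix_closed matrix_to_map_closed fin)

text \<open>Column \<open>j\<close> of the composite at \<open>x\<close> is \<open>\<phi>\<close>
  applied to column \<open>j\<close> of \<open>\<psi>\<close> at \<open>x\<close>; expanding that
  vector by \<open>residuated_eq_Join\<close> yields the row-by-column formula.\<close>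

lemma map_to_matrix_mult:
  assumes fin: "finite I" and \<phi>: "\<phi> \<in> residuated_maps (lattice_power L I)"
    and \<psi>: "\<psi> \<in> residuated_maps (lattice_power L I)"
  shows "map_to_matrix L I (\<phi> \<otimes>\<^bsub>Res (lattice_power L I)\<^esub> \<psi>) =
    map_to_matrix L I \<phi> \<otimes>\<^bsub>Mat I (Res L)\<^esub> map_to_matrix L I \<psi>"
proof (rule extensionalityI[of _ "I \<times> I"])
  fix p assume "p \<in> I \<times> I"
  then obtain i j where p: "p = (i, j)" and ij: "i \<in> I" "j \<in> I" by auto
  have mem: "map_to_matrix L I \<chi> (k, l) \<in> residuated_maps L"
    if "\<chi> \<in> residuated_maps (lattice_power L I)" "k \<in> I" "l \<in> I" for \<chi> k l
    using map_to_matrix_closed[OF that(1)] that(2,3) by (auto simp: PiE_iff)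
  have comp: "compose (carrier L) (map_to_matrix L I \<phi> (i, k)) (map_to_matrix L I \<psi> (k, j)) \<in> residuated_maps L"
    if "k \<in> I" for k
    using that ij by (intro compose_residuated mem \<phi> \<psi>)
  interpret R: abelian_monoid "Res L" by (rule abelian_monoid_Res)
  let ?S = "\<Oplus>\<^bsub>Res L\<^esub>k\<in>I. compose (carrier L) (map_to_matrix L I \<phi> (i, k)) (map_to_matrix L I \<psi> (k, j))"
  have "?S \<in> carrier (Res L)"
    using comp by (intro R.finsum_closed) auto
  then have S: "?S \<in> extensional (carrier L)"
    by (simp add: residuated_mapsD(1))
  have "map_to_matrix L I (compose (carrier (lattice_power L I)) \<phi> \<psi>) (i, j) = ?S"
  proof (rule extensionalityI[OF _ S])
    fix x assume x: "x \<in> carrier L"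
    let ?y = "\<psi> (insert_coord L I j x)"
    have y: "?y \<in> I \<rightarrow>\<^sub>E carrier L"
      using residuated_mapsD(2)[OF \<psi>] by (simp add: carrier_lattice_power insert_coord_closed x)
    have \<phi>y: "\<phi> z \<in> I \<rightarrow>\<^sub>E carrier L" if "z \<in> I \<rightarrow>\<^sub>E carrier L" for z
      using residuated_mapsD(2)[OF \<phi>] that by (simp add: carrier_lattice_power)
    have "?S x = Join L (\<lambda>k. compose (carrier L) (map_to_matrix L I \<phi> (i, k)) (map_to_matrix L I \<psi> (k, j)) x) I"
      by (rule finsum_Res) (use fin comp x in auto)
    also have "\<dots> = Join L (\<lambda>k. \<phi> (insert_coord L I k (?y k)) i) I"
      using x ij y \<phi>y[OF insert_coord_closed]
      by (intro J.finprod_cong') (auto simp: compose_def map_to_matrix_apply PiE_iff)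
    also have "\<dots> = \<phi> ?y i"
      using residuated_eq_Join[OF fin \<phi> y ij(1)] by simp
    also have "\<dots> = map_to_matrix L I (compose (carrier (lattice_power L I)) \<phi> \<psi>) (i, j) x"
      using x ij by (simp add: map_to_matrix_apply compose_def carrier_lattice_power insert_coord_closed)
    finally show "map_to_matrix L I (compose (carrier (lattice_power L I)) \<phi> \<psi>) (i, j) x = ?S x" ..
  qed (use ij in \<open>simp add: map_to_matrix_def\<close>)
  then show "map_to_matrix L I (\<phi> \<otimes>\<^bsub>Res (lattice_power L I)\<^esub> \<psi>) p =
      (map_to_matrix L I \<phi> \<otimes>\<^bsub>Mat I (Res L)\<^esub> map_to_matrix L I \<psi>) p"
    using ij by (simp add: p)
qed (simp_all add: map_to_matrix_def)

lemma map_to_matrix_one: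
  "map_to_matrix L I \<one>\<^bsub>Res (lattice_power L I)\<^esub> = \<one>\<^bsub>Mat I (Res L)\<^esub>"
  by (rule extensionalityI[of _ "I \<times> I"])
    (auto simp: map_to_matrix_def insert_coord_closed carrier_lattice_power insert_coord_def intro!: restrict_ext)

theorem bij_betw_Units_Mat_Res:
  assumes "finite I"
  shows "bij_betw (map_to_matrix L I) (Aut (lattice_power L I)) (Units (Mat I (Res L)))"
proof -
  interpret Q: lattice_bot "lattice_power L I" by (rule lattice_bot_lattice_power)
  have "bij_betw (map_to_matrix L I) (Units (Res (lattice_power L I))) (Units (Mat I (Res L)))"
  proof (rule bij_betw_Units)
    show "bij_betw (map_to_matrix L I) (carrier (Res (lattice_power L I))) (carrier (Mat I (Res L)))"
      by (rule bij_betw_map_to_matrix[OF assms])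
    show "map_to_matrix L I \<one>\<^bsub>Res (lattice_power L I)\<^esub> = \<one>\<^bsub>Mat I (Res L)\<^esub>"
      by (rule map_to_matrix_one)
    fix \<phi> \<psi>
    assume "\<phi> \<in> carrier (Res (lattice_power L I))" "\<psi> \<in> carrier (Res (lattice_power L I))"
    then have mem: "\<phi> \<in> residuated_maps (lattice_power L I)" "\<psi> \<in> residuated_maps (lattice_power L I)"
      by simp_all
    show "map_to_matrix L I (\<phi> \<otimes>\<^bsub>Res (lattice_power L I)\<^esub> \<psi>) =
        map_to_matrix L I \<phi> \<otimes>\<^bsub>Mat I (Res L)\<^esub> map_to_matrix L I \<psi>"
      by (rule map_to_matrix_mult[OF assms mem])
    show "\<phi> \<otimes>\<^bsub>Res (lattice_power L I)\<^esub> \<psi> \<in> carrier (Res (lattice_power L I))"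
      using Q.compose_residuated[OF mem] by simp
  next
    show "\<one>\<^bsub>Res (lattice_power L I)\<^esub> \<in> carrier (Res (lattice_power L I))"
      using Q.id_residuated by simp
  qed
  then show ?thesis by (simp add: Q.Units_Res)
qed

end

text \<open>The cardinal equations also describe infinite automorphism sets, on which
  \<open>card\<close> would be \<open>0\<close>; the counts in natural numbers are stated for finite
  factors.\<close>

theorem corollary4p4:
  fixes T :: "'t set" and L :: "'t \<Rightarrow> 'a gorder" and e :: "'t \<Rightarrow> nat" and I :: "'i set"
    and P :: "('t \<Rightarrow> nat \<Rightarrow> 'a) gorder"
  assumes "finite T"
    and "\<And>t. t \<in> T \<Longrightarrow> irreducible_lattice (L t)"
    and "\<And>s t. s \<in> T \<Longrightarrow> t \<in> T \<Longrightarrow> s \<noteq> t \<Longrightarrow> \<not> lattice_isomorphic (L s) (L t)"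
    and "P = lattice_prod T (\<lambda>t. lattice_power (L t) {..<e t})"
    and "finite I"
  shows "|Aut P| =o Cprod T (\<lambda>t. fincard (fact (e t)) *c |Aut (L t)| ^c fincard (e t)) \<and>
    |Aut (lattice_power P I)| =o
      Cprod T (\<lambda>t. fincard (fact (e t * card I)) *c |Aut (L t)| ^c fincard (e t * card I)) \<and>
    ((\<forall>t\<in>T. finite (carrier (L t))) \<longrightarrow>
      card (Aut P) = (\<Prod>t\<in>T. fact (e t) * card (Aut (L t)) ^ e t) \<and>
      card (Aut (lattice_power P I)) =
        (\<Prod>t\<in>T. fact (e t * card I) * card (Aut (L t)) ^ (e t * card I)) \<and>
      card (Units (Mat I (Res P))) =
        (\<Prod>t\<in>T. fact (e t * card I) * card (Aut (L t)) ^ (e t * card I)))"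
proof -
  note lat = irreducible_lattice_imp_lattice[OF assms(2)]
  have P: "lattice P"
    unfolding assms(4) lattice_power_def by (intro lattice_lattice_prod lat)
  \<comment> \<open>The index type is left polymorphic because \<open>J\<close> is instantiated both
    with \<open>I\<close> and with the one-element set \<open>{()}\<close>, the latter giving the
    formula for \<open>P\<close>.\<close>
  have Cprod: "|Aut (lattice_power P J)| =o
      Cprod T (\<lambda>t. fincard (fact (e t * card J)) *c |Aut (L t)| ^c fincard (e t * card J))"
    if "finite J" for J :: "'j set"
    using card_of_Aut_lattice_power_Cprod[of T "\<lambda>t. {..<e t}" J L] assms(1-3) that
    by (simp add: assms(4))
  have card: "card (Aut (lattice_power P J)) =
      (\<Prod>t\<in>T. fact (e t * card J) * card (Aut (L t)) ^ (e t * card J))"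
    if "finite J" for J :: "'j set"
    using card_Aut_lattice_power[of T "\<lambda>t. {..<e t}" J L] assms(1-3) that
    by (simp add: assms(4))
  have P1: "|Aut P| =o |Aut (lattice_power P {()})|"
    by (rule card_of_Aut_cong[OF lattice_power_singleton_iso[OF lattice_imp_partial_order[OF P]]])
  then have "card (Aut P) = card (Aut (lattice_power P {()}))"
    by (auto simp flip: card_of_ordIso intro: bij_betw_same_card)
  moreover have "card (Units (Mat I (Res P))) = card (Aut (lattice_power P I))"
    if fin: "\<forall>t\<in>T. finite (carrier (L t))"
  proof -
    have "lattice_bot P"
    proof (rule finite_lattice_bot[OF P])
      show "finite (carrier P)"
        using fin assms(1) by (auto simp: assms(4) lattice_power_def intro!: finite_PiE)
      have "carrier (L t) \<noteq> {}" if "t \<in> T" for t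
        using irreducible_lattice_obtain[OF assms(2)[OF that]] by blast
      then show "carrier P \<noteq> {}"
        by (simp add: assms(4) lattice_power_def PiE_eq_empty_iff)
    qed
    from bij_betw_same_card[OF lattice_bot.bij_betw_Units_Mat_Res[OF this assms(5)]]
    show ?thesis by simp
  qed
  ultimately show ?thesis
    using ordIso_transitive[OF P1 Cprod] Cprod[OF assms(5)] card[OF assms(5)] card[of "{()}"] by simp
qed

end
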